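(* For every integer $r \geq 1$, the problem Vertex $r$-Triangle $2$-Club can be solved in time $2^{\mathcal{O}(k^4)} n^{2^{\mathcal{O}(k)}}$, where $k$ is the $h$-index of the input graph and $n$ its number of vertices.
   Context: All graphs are finite, simple and undirected. A set $S \subseteq V(G)$ is a $2$-club if $G[S]$ has diameter at most $2$. A set $S$ satisfies the vertex $r$-triangle property if every $v \in S$ belongs to at least $r$ triangles of $G[S]$. Vertex $r$-Triangle $2$-Club: given a graph $G$ and an integer $\ell$, decide whether there is $S \subseteq V(G)$ with $|S| \geq \ell$ that is a $2$-club and satisfies the vertex $r$-triangle property. The $h$-index of a graph is the largest $k$ such that the graph has at least $k$ vertices each of degree at least $k$. *)

theory Defs
  imports
    "Graph_Theory.Digraph_Component"
    "Graph_Theory.Shortest_Path"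
    "HOL-Library.Landau_Symbols"
begin

text \<open>
  A finite simple undirected graph is a \<^locale>\<open>pair_graph\<close>: a finite loop-free digraph without
  parallel arcs whose arc relation is symmetric. Its degree is therefore \<^const>\<open>out_degree\<close>.
\<close>

text \<open>
  The distance is the weighted distance of the library with all arc weights 1; it is infinite
  between vertices that are not connected, so a disconnected graph has infinite diameter. The
  supremum is taken in the extended reals, so the graph without vertices has diameter
  $-\infty$ and the empty set is a 2-club.
\<close>

definition diameter :: "('a, 'b) pre_digraph \<Rightarrow> ereal" where
  "diameter H = (SUP u\<in>verts H. SUP v\<in>verts H. wf_digraph.\<mu> H (\<lambda>_. 1) u v)"

definition two_club :: "'a pair_pre_digraph \<Rightarrow> 'a set \<Rightarrow> bool" where
  "two_club G S \<longleftrightarrow> S \<subseteq> pverts G \<and> diameter (with_proj G \<restriction> S) \<le> 2"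

definition triangles :: "('a, 'b) pre_digraph \<Rightarrow> 'a set set" where
  "triangles H = {T. T \<subseteq> verts H \<and> card T = 3 \<and>
     (\<forall>u\<in>T. \<forall>v\<in>T. u \<noteq> v \<longrightarrow> u \<rightarrow>\<^bsub>H\<^esub> v)}"

definition vertex_triangle_property :: "nat \<Rightarrow> 'a pair_pre_digraph \<Rightarrow> 'a set \<Rightarrow> bool" where
  "vertex_triangle_property r G S \<longleftrightarrow>
     (\<forall>v\<in>S. r \<le> card {T \<in> triangles (with_proj G \<restriction> S). v \<in> T})"

definition vertex_triangle_2_club :: "nat \<Rightarrow> 'a pair_pre_digraph \<Rightarrow> nat \<Rightarrow> bool" where
  "vertex_triangle_2_club r G l \<longleftrightarrow>
     (\<exists>S \<subseteq> pverts G. l \<le> card S \<and> two_club G S \<and> vertex_triangle_property r G S)"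

definition h_index :: "'a pair_pre_digraph \<Rightarrow> nat" where
  "h_index G = Max {k. k \<le> card {v \<in> pverts G. k \<le> out_degree (with_proj G) v}}"


text \<open>
  The model of computation is a deterministic random access machine, programmed in a structured
  while-language. Memory consists of arrays of natural numbers selected by name, a program
  accessing only the finitely many arrays named in it; a scalar variable is cell 0 of an array.
  Indirect addressing is available through nested reads. The arithmetic operations are addition
  and truncated subtraction at unit cost. There is deliberately no unit-cost multiplication, so that
  values grow by at most a constant number of bits per step and running times agree with
  those of Turing machines up to a polynomial.
\<close>

type_synonym state = "string \<Rightarrow> nat \<Rightarrow> nat"

datatype expr =
    Const nat
  | Read string expr
  | Plus expr expr
  | Minus expr expr

primrec val :: "expr \<Rightarrow> state \<Rightarrow> nat" where
  "val (Const m) s = m"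
| "val (Read x a) s = s x (val a s)"
| "val (Plus a b) s = val a s + val b s"
| "val (Minus a b) s = val a s - val b s"

primrec cost :: "expr \<Rightarrow> nat" where
  "cost (Const m) = 1"
| "cost (Read x a) = cost a + 1"
| "cost (Plus a b) = cost a + cost b + 1"
| "cost (Minus a b) = cost a + cost b + 1"

datatype com =
    Skip
  | Write string expr expr
  | Seq com com
  | If expr com com
  | While expr com

text \<open>
  \<open>exec c s t s'\<close>: started in \<open>s\<close>, the program \<open>c\<close> halts in \<open>s'\<close> after exactly \<open>t\<close> steps.
  A test succeeds iff its value is nonzero.
\<close>

inductive exec :: "com \<Rightarrow> state \<Rightarrow> nat \<Rightarrow> state \<Rightarrow> bool" where
  Skip: "exec Skip s 1 s"
| Write: "exec (Write x a b) s (cost a + cost b + 1) (s(x := (s x)(val a s := val b s)))"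
| Seq: "exec c s t s' \<Longrightarrow> exec d s' t' s'' \<Longrightarrow> exec (Seq c d) s (t + t') s''"
| IfTrue: "val b s \<noteq> 0 \<Longrightarrow> exec c s t s' \<Longrightarrow> exec (If b c d) s (cost b + 1 + t) s'"
| IfFalse: "val b s = 0 \<Longrightarrow> exec d s t s' \<Longrightarrow> exec (If b c d) s (cost b + 1 + t) s'"
| WhileFalse: "val b s = 0 \<Longrightarrow> exec (While b c) s (cost b + 1) s"
| WhileTrue: "val b s \<noteq> 0 \<Longrightarrow> exec c s t s' \<Longrightarrow> exec (While b c) s' t' s'' \<Longrightarrow>
    exec (While b c) s (cost b + 1 + t + t') s''"

inductive_cases exec_SkipE: "exec Skip s t s'"
  and exec_WriteE: "exec (Write x a b) s t s'"
  and exec_SeqE: "exec (Seq c d) s t s'"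
  and exec_IfE: "exec (If b c d) s t s'"
  and exec_WhileE: "exec (While b c) s t s'"

lemma exec_deterministic:
  "exec c s t s' \<Longrightarrow> exec c s u s'' \<Longrightarrow> t = u \<and> s' = s''"
proof (induction arbitrary: u s'' rule: exec.induct)
  case Skip
  then show ?case by (auto elim: exec_SkipE)
next
  case Write
  then show ?case by (auto elim: exec_WriteE)
next
  case (Seq c s t s' d t' s2)
  from Seq.prems obtain v w r where "u = v + w" "exec c s v r" "exec d r w s''"
    by (rule exec_SeqE)
  with Seq.IH show ?case by metis
next
  case (IfTrue b s c t s' d)
  from IfTrue.prems obtain v where "u = cost b + 1 + v" "exec c s v s''"
    by (rule exec_IfE) (use IfTrue.hyps in simp_all)
  with IfTrue.IH show ?case by metis
next
  case (IfFalse b s d t s' c)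
  from IfFalse.prems obtain v where "u = cost b + 1 + v" "exec d s v s''"
    by (rule exec_IfE) (use IfFalse.hyps in simp_all)
  with IfFalse.IH show ?case by metis
next
  case (WhileFalse b s c)
  from WhileFalse.prems show ?case
    by (rule exec_WhileE) (use WhileFalse.hyps in simp_all)
next
  case (WhileTrue b s c t s' t' s2)
  from WhileTrue.prems obtain v w r
    where "u = cost b + 1 + v + w" "exec c s v r" "exec (While b c) r w s''"
    by (rule exec_WhileE) (use WhileTrue.hyps in simp_all)
  with WhileTrue.IH show ?case by metis
qed

text \<open>
  Instances are graphs with vertex set \<open>{..<n}\<close>. The input consists of \<open>n\<close>, the row-wise
  adjacency matrix and the threshold; every other cell is 0.
\<close>

definition input_state :: "nat pair_pre_digraph \<Rightarrow> nat \<Rightarrow> state" where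
  "input_state G l =
    (let n = card (pverts G) in
     (\<lambda>x i. 0)
       (''n'' := (\<lambda>i. 0)(0 := n),
        ''l'' := (\<lambda>i. 0)(0 := l),
        ''adj'' := (\<lambda>i. if i < n * n \<and> (i div n, i mod n) \<in> parcs G then 1 else 0)))"

definition answers_in_time :: "com \<Rightarrow> state \<Rightarrow> bool \<Rightarrow> nat \<Rightarrow> bool" where
  "answers_in_time p s b t \<longleftrightarrow>
     (\<exists>t' \<le> t. \<exists>s'. exec p s t' s' \<and> s' ''out'' 0 = (if b then 1 else 0))"

end

theory Submission
  imports Defs
begin

text \<open>
  Let \<open>k\<close> be the \<open>h\<close>-index and \<open>X\<close> the set of the at most \<open>k\<close> vertices of degree greater than
  \<open>k\<close>. Classify the vertices of a solution \<open>S\<close> outside \<open>X\<close> by their neighbourhood in \<open>S \<inter> X\<close>. If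
  this neighbourhood meets that of every vertex of \<open>S - X\<close>, the vertex is automatically close to all
  of \<open>S - X\<close>. Otherwise its class is confined to a ball of radius 2 in \<open>G - X\<close>, hence has at most
  \<open>1 + k + k\<^sup>2\<close> elements. So \<open>S\<close> contains a set \<open>F\<close> of at most \<open>2 * 8 ^ k\<close> vertices consisting of
  \<open>S \<inter> X\<close>, all small classes and one representative of each remaining class. Given \<open>F\<close>, take
  all vertices that look like a representative and repeatedly delete those outside \<open>F\<close> that are
  too far from another vertex or lie in too few triangles. No vertex of \<open>S\<close> is ever deleted, and
  what remains is a solution. Trying all tuples of length \<open>2 * 8 ^ k\<close> as \<open>F\<close> takes time
  \<open>n ^ (2 * 8 ^ k)\<close> up to a factor polynomial in \<open>n + 8 ^ k\<close>.
\<close>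

section \<open>Guessing and pruning\<close>

text \<open>Distances are not hereditary: deleting a vertex may move two others apart, so in general
  bad vertices cannot simply be discarded one after another. A correct guess removes this obstacle.
  A vertex of \<open>S\<close> outside \<open>F\<close> shares a neighbour in
  \<open>S \<inter> X\<close> with every vertex of \<open>S - X\<close>, hence with every look-alike
  of one, and \<open>S \<inter> X\<close> lies in \<open>F\<close> and is never deleted. The
  vertices of \<open>F\<close> are exempt from deletion; they end up near all survivors because
  nearness is symmetric. The width \<open>2 * 8 ^ k\<close> of a guess is the whole source of the
  exponent of \<open>n\<close>. All other work is polynomial in \<open>n + 8 ^ k\<close>, so it
  contributes only a factor \<open>2 ^ (c + c * k)\<close> besides powers of \<open>n\<close>. For
  timing on the machine, programs are written in a language in which every loop count is fixed on
  entry. Their cost is then read off the syntax as a polynomial in a common bound on these counts.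
  Only the loop over all tuples exceeds that bound, and it is accounted for separately.\<close>

definition near :: "('a \<Rightarrow> 'a \<Rightarrow> bool) \<Rightarrow> 'a set \<Rightarrow> 'a \<Rightarrow> 'a \<Rightarrow> bool" where
  "near E U u v \<longleftrightarrow> u = v \<or> E u v \<or> (\<exists>w\<in>U. E u w \<and> E w v)"

text \<open>Each triangle at \<open>v\<close> has one opposite edge, and \<open>x < y\<close> keeps
  one of its two orientations. Pairs, unlike sets, can be counted by a nested sum.\<close>

definition links :: "('a::linorder \<Rightarrow> 'a \<Rightarrow> bool) \<Rightarrow> 'a set \<Rightarrow> 'a \<Rightarrow> ('a \<times> 'a) set" where
  "links E U v = {(x, y). x \<in> U \<and> y \<in> U \<and> x < y \<and> E v x \<and> E v y \<and> E x y}"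

definition good :: "('a::linorder \<Rightarrow> 'a \<Rightarrow> bool) \<Rightarrow> nat \<Rightarrow> 'a set \<Rightarrow> 'a \<Rightarrow> bool" where
  "good E r U v \<longleftrightarrow> (\<forall>u\<in>U. near E U u v) \<and> r \<le> card (links E U v)"

text \<open>\<open>F \<inter> X\<close> stands for the unknown \<open>S \<inter> X\<close>. The
  second condition keeps out classes disjoint from a guessed vertex: for a correct guess their
  members in \<open>S\<close> are all listed in \<open>F\<close> already.\<close>

definition candidates :: "('a \<Rightarrow> 'a \<Rightarrow> bool) \<Rightarrow> 'a set \<Rightarrow> 'a set \<Rightarrow> 'a set \<Rightarrow> 'a set" where
  "candidates E V X F = F \<union> {v \<in> V - X. (\<exists>f\<in>F - X. \<forall>x\<in>F \<inter> X. E v x \<longleftrightarrow> E f x) \<and>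
     (\<forall>g\<in>F - X. \<exists>x\<in>F \<inter> X. E v x \<and> E g x)}"

text \<open>A vertex of \<open>F\<close> may be far from candidates that are still to be deleted, so
  failing the test must not remove it. It is judged only by the final test in
  \<open>accepts\<close>.\<close>

definition prune :: "('a::linorder \<Rightarrow> 'a \<Rightarrow> bool) \<Rightarrow> nat \<Rightarrow> 'a set \<Rightarrow> 'a set \<Rightarrow> 'a set" where
  "prune E r F U = {v \<in> U. v \<in> F \<or> good E r U v}"

definition accepts :: "('a::linorder \<Rightarrow> 'a \<Rightarrow> bool) \<Rightarrow> nat \<Rightarrow> 'a set \<Rightarrow> 'a set \<Rightarrow> nat \<Rightarrow> 'a set \<Rightarrow> bool" where
  "accepts E r V X l F \<longleftrightarrow> (let U = (prune E r F ^^ card V) (candidates E V X F)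
     in (\<forall>v\<in>U. good E r U v) \<and> l \<le> card U)"

definition solution :: "('a::linorder \<Rightarrow> 'a \<Rightarrow> bool) \<Rightarrow> nat \<Rightarrow> 'a set \<Rightarrow> 'a set \<Rightarrow> nat \<Rightarrow> bool" where
  "solution E r V S l \<longleftrightarrow> S \<subseteq> V \<and> (\<forall>v\<in>S. good E r S v) \<and> l \<le> card S"

lemma near_mono: "near E U u v \<Longrightarrow> U \<subseteq> U' \<Longrightarrow> near E U' u v"
  unfolding near_def by blast

lemma near_sym: "symp E \<Longrightarrow> near E U u v \<Longrightarrow> near E U v u"
  unfolding near_def symp_def by blast

lemma finite_links: "finite U \<Longrightarrow> finite (links E U v)"
  by (rule finite_subset[of _ "U \<times> U"]) (auto simp: links_def)

lemma card_links_mono: "finite U' \<Longrightarrow> U \<subseteq> U' \<Longrightarrow> card (links E U v) \<le> card (links E U' v)"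
  by (intro card_mono finite_links) (auto simp: links_def)

lemma prune_pow_subset: "(prune E r F ^^ i) U \<subseteq> U"
  by (induction i) (auto simp: prune_def)

lemma candidates_subset: "F \<subseteq> V \<Longrightarrow> candidates E V X F \<subseteq> V"
  by (auto simp: candidates_def)

text \<open>As long as the set has not stabilised, every round removes a vertex.\<close>

lemma prune_stable:
  assumes "finite V" "U \<subseteq> V"
  shows "prune E r F ((prune E r F ^^ card V) U) = (prune E r F ^^ card V) U"
proof -
  let ?P = "\<lambda>i. (prune E r F ^^ i) U"
  have fin: "finite (?P i)" for i
    using prune_pow_subset assms by (metis finite_subset)
  have "?P (Suc i) = ?P i \<or> card (?P i) + i \<le> card V" for i
  proof (induction i)
    case 0
    then show ?case using assms by (simp add: card_mono)
  next
    case (Suc i)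
    show ?case
    proof (cases "?P (Suc i) = ?P i")
      case True
      then show ?thesis by simp
    next
      case False
      then have "?P (Suc i) \<subset> ?P i" by (auto simp: prune_def)
      then have "card (?P (Suc i)) < card (?P i)" using fin by (intro psubset_card_mono)
      then show ?thesis using Suc False by linarith
    qed
  qed
  \<comment> \<open>In the second alternative the set is empty after \<open>card V\<close> rounds,
    and the empty set is a fixed point too.\<close>
  from this[of "card V"] show ?thesis
    using fin[of "card V"] by (auto simp: prune_def)
qed

text \<open>The final test says precisely that the surviving set is a solution, so a wrong guess
  cannot produce a wrong positive answer.\<close>

lemma accepts_sound:
  assumes "F \<subseteq> V" "accepts E r V X l F"
  shows "\<exists>S. solution E r V S l"
  using assms prune_pow_subset candidates_subset
  unfolding accepts_def solution_def Let_def by (metis subset_trans)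

text \<open>\<open>type\<close> and \<open>meet\<close> are what makes a guess correct. The
  invariant \<open>S \<subseteq> ?P i\<close> survives each round because links only grow with the
  set and because survivors outside \<open>S\<close> imitate vertices of \<open>F\<close>.\<close>

lemma accepts_complete:
  assumes fin: "finite V" and sym: "symp E"
    and S: "solution E r V S l" and FS: "F \<subseteq> S" and XF: "S \<inter> X \<subseteq> F"
    and type: "\<forall>v\<in>S - X. \<exists>f\<in>F - X. \<forall>x\<in>S \<inter> X. E v x \<longleftrightarrow> E f x"
    and meet: "\<forall>v\<in>S - X - F. \<forall>g\<in>S - X. \<exists>x\<in>S \<inter> X. E v x \<and> E g x"
  shows "accepts E r V X l F"
proof -
  have SV: "S \<subseteq> V" and goodS: "\<And>v. v \<in> S \<Longrightarrow> good E r S v" and l: "l \<le> card S"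
    using S by (auto simp: solution_def)
  let ?C = "candidates E V X F"
  let ?P = "\<lambda>i. (prune E r F ^^ i) ?C"
  have FX: "F \<inter> X = S \<inter> X" using FS XF by blast
  have PC: "?P i \<subseteq> ?C" for i by (rule prune_pow_subset)
  have CV: "?C \<subseteq> V" using FS SV by (intro candidates_subset) blast
  then have finP: "finite (?P i)" for i using fin PC by (meson finite_subset)
  have SP: "S \<subseteq> ?P i" for i
  proof (induction i)
    case 0
    have "S - F \<subseteq> ?C"
      using XF SV type meet FS unfolding candidates_def FX by blast
    then show ?case by (auto simp: candidates_def)
  next
    case (Suc i)
    have "good E r (?P i) v" if v: "v \<in> S - F" for v
    proof -
      have vX: "v \<in> S - X - F" using v XF by blast
      have "near E (?P i) u v" if u: "u \<in> ?P i" for u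
      proof (cases "u \<in> S")
        case True
        then have "near E S u v" using goodS[of v] v by (simp add: good_def)
        then show ?thesis using Suc by (rule near_mono)
      next
        case False
        \<comment> \<open>\<open>u\<close> has the same neighbours in \<open>S \<inter> X\<close> as
          some \<open>f\<close> in \<open>F - X\<close>. The common neighbour of \<open>v\<close>
          and \<open>f\<close> given by \<open>meet\<close> is therefore one of \<open>v\<close> and
          \<open>u\<close>, and it is still present.\<close>
        then obtain f where f: "f \<in> F - X" "\<forall>x\<in>S \<inter> X. E u x \<longleftrightarrow> E f x"
          using subsetD[OF PC u] FS unfolding candidates_def FX by blast
        then obtain x where x: "x \<in> S \<inter> X" "E v x" "E f x" using bspec[OF meet vX] FS by blast
        then have "x \<in> ?P i" "E u x" "E x v" using f(2) Suc sym by (auto dest: sympD)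
        then show ?thesis unfolding near_def by blast
      qed
      moreover have "r \<le> card (links E (?P i) v)"
        using goodS[of v] v card_links_mono[OF finP Suc, of E v] by (simp add: good_def)
      ultimately show ?thesis by (simp add: good_def)
    qed
    with Suc have "S \<subseteq> prune E r F (?P i)" unfolding prune_def by blast
    then show ?case by simp
  qed
  let ?U = "?P (card V)"
  have stable: "good E r ?U v" if "v \<in> ?U - F" for v
    using prune_stable[OF fin CV, of E r F] that unfolding prune_def by blast
  have "good E r ?U v" if v: "v \<in> ?U" for v
  proof (cases "v \<in> F")
    case True
    then have vS: "v \<in> S" using FS by blast
    have "near E ?U u v" if u: "u \<in> ?U" for u
    proof (cases "u \<in> S")
      case True
      then have "near E S u v" using goodS[OF vS] by (simp add: good_def)
      then show ?thesis using SP by (rule near_mono)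
    next
      case False
      \<comment> \<open>A survivor outside \<open>F\<close> passed the last round, so it is near
        \<open>v\<close>; symmetry turns this into a statement about \<open>v\<close>.\<close>
      then have "good E r ?U u" using stable u FS by blast
      then show ?thesis using v near_sym[OF sym] unfolding good_def by blast
    qed
    moreover have "r \<le> card (links E ?U v)"
      using goodS[OF vS] card_links_mono[OF finP SP, of E v "card V"]
      unfolding good_def by linarith
    ultimately show ?thesis by (simp add: good_def)
  next
    case False
    then show ?thesis using stable v by blast
  qed
  moreover have "l \<le> card ?U" using l card_mono[OF finP SP] by (rule order_trans)
  ultimately show ?thesis by (simp add: accepts_def Let_def)
qed

text \<open>
  Two vertices outside \<open>X\<close> without a common neighbour in \<open>S \<inter> X\<close> are joined through a vertex
  of degree at most \<open>k\<close>. Hence a class of vertices with the same neighbourhood in \<open>S \<inter> X\<close>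
  is small as soon as that neighbourhood is disjoint from the one of a further vertex of \<open>S\<close>.
\<close>

lemma guess_exists:
  assumes fin: "finite V" and sym: "symp E" and edge: "\<And>u v. E u v \<Longrightarrow> v \<in> V"
    and X: "finite X" "card X \<le> k" and deg: "\<And>v. v \<in> V - X \<Longrightarrow> card {w. E v w} \<le> k"
    and S: "S \<subseteq> V" and near: "\<And>u v. u \<in> S \<Longrightarrow> v \<in> S \<Longrightarrow> near E S u v"
  obtains F where "card F \<le> k + 2 ^ k * (1 + k + k * k)" "F \<subseteq> S" "S \<inter> X \<subseteq> F"
    "\<forall>v\<in>S - X. \<exists>f\<in>F - X. \<forall>x\<in>S \<inter> X. E v x \<longleftrightarrow> E f x"
    "\<forall>v\<in>S - X - F. \<forall>g\<in>S - X. \<exists>x\<in>S \<inter> X. E v x \<and> E g x"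
proof -
  define W where "W = S - X"
  define T where "T v = {x \<in> S \<inter> X. E v x}" for v
  define rep where "rep t = (SOME v. v \<in> W \<and> T v = t)" for t
  have rep: "rep t \<in> W" "T (rep t) = t" if "t \<in> T ` W" for t
    using that someI_ex[of "\<lambda>v. v \<in> W \<and> T v = t"] unfolding rep_def by blast+
  define C where "C t = (if \<exists>u\<in>W. t \<inter> T u = {} then {v \<in> W. T v = t} else {rep t})" for t
  define F where "F = (S \<inter> X) \<union> (\<Union>t\<in>T ` W. C t)"
  have finN: "finite {w. E u w}" for u using fin edge by (auto intro: finite_subset)
  have cardC: "card (C t) \<le> 1 + k + k * k" if t: "t \<in> T ` W" for t
  proof (cases "\<exists>u\<in>W. t \<inter> T u = {}")
    case False
    then have "C t = {rep t}" unfolding C_def by (rule if_not_P)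
    then show ?thesis by simp
  next
    case True
    then obtain u where u: "u \<in> W" "t \<inter> T u = {}" by blast
    let ?N = "{w. E u w} - X"
    have C: "C t = {v \<in> W. T v = t}" using True unfolding C_def by (rule if_P)
    \<comment> \<open>A middle vertex in \<open>X\<close> on the way from \<open>u\<close> to
      \<open>v\<close> would lie in both \<open>T u\<close> and \<open>t\<close>. So
      \<open>v\<close> is \<open>u\<close>, a neighbour of \<open>u\<close>, or a neighbour of a
      neighbour outside \<open>X\<close>, which gives the summands \<open>1\<close>,
      \<open>k\<close> and \<open>k * k\<close>.\<close>
    have "C t \<subseteq> {u} \<union> {w. E u w} \<union> (\<Union>w\<in>?N. {v. E w v})" (is "_ \<subseteq> ?R")
    proof
      fix v assume v: "v \<in> C t"
      then have "near E S u v" using u(1) near unfolding C W_def by blast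
      moreover have False if "w \<in> S" "w \<in> X" "E u w" "E w v" for w
        using that u(2) v sympD[OF sym] unfolding C T_def by blast
      ultimately show "v \<in> ?R" unfolding near_def by blast
    qed
    moreover have "finite ?R" using finN by auto
    ultimately have "card (C t) \<le> card ?R" by (rule card_mono[rotated])
    also have "\<dots> \<le> card ({u} \<union> {w. E u w}) + card (\<Union>w\<in>?N. {v. E w v})"
      by (rule card_Un_le)
    also have "card ({u} \<union> {w. E u w}) \<le> 1 + k"
    proof -
      have "card ({u} \<union> {w. E u w}) \<le> card {u} + card {w. E u w}" by (rule card_Un_le)
      also have "\<dots> \<le> 1 + k" using deg[of u] u(1) S by (auto simp: W_def)
      finally show ?thesis .
    qed
    also have "card (\<Union>w\<in>?N. {v. E w v}) \<le> (\<Sum>w\<in>?N. card {v. E w v})"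
      using finN by (intro card_UN_le) auto
    also have "\<dots> \<le> (\<Sum>w\<in>?N. k)"
      using edge by (intro sum_mono deg) auto
    also have "\<dots> \<le> k * k"
    proof -
      have "card ?N \<le> card {w. E u w}" using finN by (intro card_mono) auto
      also have "\<dots> \<le> k" using deg[of u] u(1) S by (auto simp: W_def)
      finally show ?thesis by simp
    qed
    finally show ?thesis by simp
  qed
  have finS: "finite S" using fin S by (rule finite_subset[rotated])
  have finSX: "finite (S \<inter> X)" "card (S \<inter> X) \<le> k"
    using X card_mono[of X "S \<inter> X"] by auto
  have "T ` W \<subseteq> Pow (S \<inter> X)" by (auto simp: T_def)
  moreover have "finite (Pow (S \<inter> X))" using finSX(1) by (simp only: finite_Pow_iff)
  ultimately have "card (T ` W) \<le> card (Pow (S \<inter> X))" by (rule card_mono[rotated])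
  also have "\<dots> \<le> 2 ^ k" by (subst card_Pow) (use finSX in simp_all)
  finally have cardT: "card (T ` W) \<le> 2 ^ k" .
  have "card (\<Union>t\<in>T ` W. C t) \<le> (\<Sum>t\<in>T ` W. card (C t))"
    using finS by (intro card_UN_le) (auto simp: W_def)
  also have "\<dots> \<le> (\<Sum>t\<in>T ` W. 1 + k + k * k)" by (intro sum_mono cardC)
  also have "\<dots> \<le> 2 ^ k * (1 + k + k * k)"
    using cardT by (simp only: sum_constant of_nat_id mult_right_mono)
  finally have "card F \<le> k + 2 ^ k * (1 + k + k * k)"
    using card_Un_le[of "S \<inter> X" "\<Union>t\<in>T ` W. C t"] finSX unfolding F_def by linarith
  moreover have CW: "C t \<subseteq> W" if "t \<in> T ` W" for t using rep[OF that] by (auto simp: C_def)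
  then have "F \<subseteq> S" unfolding F_def W_def by blast
  moreover have "S \<inter> X \<subseteq> F" by (simp add: F_def)
  moreover have "\<forall>v\<in>S - X. \<exists>f\<in>F - X. \<forall>x\<in>S \<inter> X. E v x \<longleftrightarrow> E f x"
  proof
    fix v assume v: "v \<in> S - X"
    have t: "T v \<in> T ` W" using v by (simp add: W_def)
    then have "rep (T v) \<in> C (T v)" using rep by (simp add: C_def)
    then have "rep (T v) \<in> F - X" using t CW[OF t] by (auto simp: F_def W_def)
    moreover have "T (rep (T v)) = T v" using rep(2)[OF t] .
    ultimately obtain f where "f \<in> F - X" "T f = T v" by blast
    then show "\<exists>f\<in>F - X. \<forall>x\<in>S \<inter> X. E v x \<longleftrightarrow> E f x" unfolding T_def by blast
  qed
  moreover have "\<forall>v\<in>S - X - F. \<forall>g\<in>S - X. \<exists>x\<in>S \<inter> X. E v x \<and> E g x"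
  proof (intro ballI, rule ccontr)
    fix v g assume v: "v \<in> S - X - F" and g: "g \<in> S - X"
    assume "\<not> (\<exists>x\<in>S \<inter> X. E v x \<and> E g x)"
    then have "T v \<inter> T g = {}" by (auto simp: T_def)
    then have "\<exists>u\<in>W. T v \<inter> T u = {}" using g by (auto simp: W_def)
    then have "v \<in> C (T v)" using v by (simp add: C_def W_def)
    then show False using v by (auto simp: F_def W_def)
  qed
  ultimately show thesis by (rule that)
qed

text \<open>\<open>1 + k + k * k\<close> is at most \<open>4 ^ k\<close>, and
  \<open>2 ^ k * 4 ^ k = 8 ^ k\<close>. The rounded value can be computed by repeated doubling
  alone, and its logarithm is linear in \<open>k\<close>.\<close>

lemma guess_size: "k + 2 ^ k * (1 + k + k * k) \<le> 2 * 8 ^ (k::nat)"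
proof -
  have "1 + k + k * k \<le> 4 ^ k" by (induction k) auto
  then have "2 ^ k * (1 + k + k * k) \<le> 2 ^ k * 4 ^ k"
    by (rule mult_left_mono) simp
  also have "\<dots> = 8 ^ k" by (simp flip: power_mult_distrib)
  finally have "2 ^ k * (1 + k + k * k) \<le> 8 ^ k" .
  moreover have "k \<le> 8 ^ k" using less_exp[of k] power_mono[of 2 8 k] by simp
  ultimately show ?thesis by linarith
qed

section \<open>Reduction of the graph library notions\<close>

lemma distance_le_2_iff:
  assumes "wf_digraph H" "u \<in> verts H"
  shows "wf_digraph.\<mu> H (\<lambda>_. 1) u v \<le> 2 \<longleftrightarrow> near (\<lambda>x y. (x, y) \<in> arcs_ends H) (verts H) u v"
proof -
  interpret wf_digraph H by fact
  have cost: "awalk_cost (\<lambda>_. 1) p = length p" for p by (induction p) auto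
  have "\<mu> (\<lambda>_. 1) u v \<le> 2 \<longleftrightarrow> (\<exists>p. awalk u p v \<and> length p \<le> 2)" (is "_ \<longleftrightarrow> ?W")
  proof
    assume "\<mu> (\<lambda>_. 1) u v \<le> 2"
    \<comment> \<open>Relaxing to a strict bound lets the infimum deliver an actual walk; since
      lengths are integers, nothing is lost.\<close>
    then have "(INF p\<in>{p. awalk u p v}. ereal (awalk_cost (\<lambda>_. 1) p)) < 3"
      unfolding \<mu>_def by (rule le_less_trans) simp
    then obtain p where "awalk u p v" "ereal (length p) < 3"
      unfolding INF_less_iff cost by blast
    moreover from this(2) have "ereal (length p) < ereal 3" by simp
    then have "length p \<le> 2" by simp
    ultimately show ?W by blast
  next
    assume ?W
    then obtain p where "awalk u p v" "length p \<le> 2" by blast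
    then have "\<mu> (\<lambda>_. 1) u v \<le> ereal (length p)" using min_cost_le_walk_cost[of u p v] cost by metis
    also have "\<dots> \<le> ereal 2" using \<open>length p \<le> 2\<close> by simp
    finally show "\<mu> (\<lambda>_. 1) u v \<le> 2" by simp
  qed
  also have "?W \<longleftrightarrow> near (\<lambda>x y. (x, y) \<in> arcs_ends H) (verts H) u v"
  proof
    assume ?W
    then obtain p where p: "awalk u p v" "length p \<le> 2" by blast
    then consider "p = []" | e where "p = [e]" | e f where "p = [e, f]"
      by (cases p; cases "tl p") auto
    then show "near (\<lambda>x y. (x, y) \<in> arcs_ends H) (verts H) u v"
    proof cases
      case 1
      then show ?thesis using p by (simp add: near_def awalk_def)
    next
      case 2
      then have "(u, v) \<in> arcs_ends H" using p(1) by (auto simp: awalk_def arcs_ends_conv)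
      then show ?thesis by (simp add: near_def)
    next
      case (3 e f)
      then have "e \<in> arcs H" "f \<in> arcs H" "tail H e = u" "tail H f = head H e" "head H f = v"
        using p(1) by (auto simp: awalk_def)
      then have "(u, head H e) \<in> arcs_ends H" "(head H e, v) \<in> arcs_ends H" "head H e \<in> verts H"
        unfolding arcs_ends_conv by (force, force, simp)
      then show ?thesis by (auto simp: near_def)
    qed
  next
    assume "near (\<lambda>x y. (x, y) \<in> arcs_ends H) (verts H) u v"
    then consider "u = v" | "(u, v) \<in> arcs_ends H"
      | w where "(u, w) \<in> arcs_ends H" "(w, v) \<in> arcs_ends H"
      unfolding near_def by blast
    then show ?W
    proof cases
      case 1
      then show ?thesis using assms(2) by (intro exI[of _ "[]"]) (simp add: awalk_def)
    next
      case 2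
      then obtain e where "e \<in> arcs H" "tail H e = u" "head H e = v" by (auto simp: arcs_ends_conv)
      then show ?thesis using assms(2) by (intro exI[of _ "[e]"]) (simp add: awalk_def)
    next
      case 3
      then obtain e f where "e \<in> arcs H" "tail H e = u" "head H e = w"
        "f \<in> arcs H" "tail H f = w" "head H f = v" by (auto simp: arcs_ends_conv)
      then show ?thesis using assms(2) by (intro exI[of _ "[e, f]"]) (simp add: awalk_def)
    qed
  qed
  finally show ?thesis .
qed

lemma arcs_ends_induced: "arcs_ends (with_proj G \<restriction> S) = {(u, v) \<in> parcs G. u \<in> S \<and> v \<in> S}"
  by (auto simp: arcs_ends_conv)

lemma two_club_iff:
  assumes "pair_graph G"
  shows "two_club G S \<longleftrightarrow>
    S \<subseteq> pverts G \<and> (\<forall>u\<in>S. \<forall>v\<in>S. near (\<lambda>x y. (x, y) \<in> parcs G) S u v)"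
proof -
  interpret pair_graph G by fact
  have "diameter (with_proj G \<restriction> S) \<le> 2 \<longleftrightarrow>
      (\<forall>u\<in>S. \<forall>v\<in>S. wf_digraph.\<mu> (with_proj G \<restriction> S) (\<lambda>_. 1) u v \<le> 2)"
    unfolding diameter_def by (simp add: SUP_le_iff)
  also have "\<dots> \<longleftrightarrow> (\<forall>u\<in>S. \<forall>v\<in>S. near (\<lambda>x y. (x, y) \<in> parcs G) S u v)"
    using distance_le_2_iff[OF wellformed_induce_subgraph[of S]]
    by (auto simp: near_def arcs_ends_induced)
  finally show ?thesis unfolding two_club_def by blast
qed

lemma card_triangles:
  assumes "pair_graph G" and "v \<in> S" and "finite S"
  shows "card {T \<in> triangles (with_proj G \<restriction> S). v \<in> T} = card (links (\<lambda>x y. (x, y) \<in> parcs G) S v)"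
proof -
  interpret pair_graph G by fact
  let ?E = "\<lambda>x y. (x, y) \<in> parcs G"
  have sym: "?E x y \<Longrightarrow> ?E y x" for x y using pair_sym_arcs by (auto simp: symmetric_def dest: symD)
  have "bij_betw (\<lambda>(x, y). {v, x, y}) (links ?E S v) {T \<in> triangles (with_proj G \<restriction> S). v \<in> T}"
    unfolding bij_betw_def
  proof
    \<comment> \<open>Without loops, \<open>x\<close> and \<open>y\<close> differ from
      \<open>v\<close>, so the triangle determines the set of the two, and the order determines the
      pair.\<close>
    show "inj_on (\<lambda>(x, y). {v, x, y}) (links ?E S v)"
      using no_loops' by (auto simp: inj_on_def links_def doubleton_eq_iff insert_eq_iff)
    show "(\<lambda>(x, y). {v, x, y}) ` links ?E S v = {T \<in> triangles (with_proj G \<restriction> S). v \<in> T}"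
    proof (intro equalityI subsetI)
      fix T assume "T \<in> (\<lambda>(x, y). {v, x, y}) ` links ?E S v"
      then obtain x y where T: "T = {v, x, y}" and xy: "(x, y) \<in> links ?E S v" by auto
      then have "v \<noteq> x" "v \<noteq> y" "x \<noteq> y" using no_loops' by (auto simp: links_def)
      with T xy sym assms(2) show "T \<in> {T \<in> triangles (with_proj G \<restriction> S). v \<in> T}"
        by (auto simp: triangles_def links_def arcs_ends_induced)
    next
      fix T assume T: "T \<in> {T \<in> triangles (with_proj G \<restriction> S). v \<in> T}"
      then have "card (T - {v}) = 2" by (simp add: triangles_def)
      then obtain a b where ab: "T - {v} = {a, b}" "a \<noteq> b" by (auto simp: card_2_iff)
      obtain x y where xy: "T - {v} = {x, y}" "x < y"
        using ab that[of a b] that[of b a] by (metis insert_commute neqE)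
      then have Tv: "T = {v, x, y}" "x < y" "x \<in> T" "y \<in> T" "x \<noteq> v" "y \<noteq> v" using T by blast+
      then have "(x, y) \<in> links ?E S v"
        using T by (auto simp: triangles_def links_def arcs_ends_induced)
      with Tv(1) show "T \<in> (\<lambda>(x, y). {v, x, y}) ` links ?E S v" by force
    qed
  qed
  then show ?thesis by (simp add: bij_betw_same_card)
qed

lemma vertex_triangle_2_club_iff:
  assumes "pair_graph G"
  shows "vertex_triangle_2_club r G l \<longleftrightarrow> (\<exists>S. solution (\<lambda>x y. (x, y) \<in> parcs G) r (pverts G) S l)"
proof -
  interpret pair_graph G by fact
  let ?E = "\<lambda>x y. (x, y) \<in> parcs G"
  have triangle: "vertex_triangle_property r G S \<longleftrightarrow> (\<forall>v\<in>S. r \<le> card (links (\<lambda>x y. (x, y) \<in> parcs G) S v))"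
    if "S \<subseteq> pverts G" for S
    using card_triangles[OF assms] finite_subset[OF that pair_finite_verts]
    by (simp add: vertex_triangle_property_def)
  have "solution ?E r (pverts G) S l \<longleftrightarrow>
      S \<subseteq> pverts G \<and> l \<le> card S \<and> two_club G S \<and> vertex_triangle_property r G S" for S
  proof (cases "S \<subseteq> pverts G")
    case True
    have "(\<forall>v\<in>S. \<forall>u\<in>S. near ?E S u v) \<longleftrightarrow> (\<forall>u\<in>S. \<forall>v\<in>S. near ?E S u v)" by blast
    then show ?thesis
      using True by (simp add: solution_def good_def two_club_iff[OF assms] triangle ball_conj_distrib) argo
  qed (simp add: solution_def)
  then show ?thesis by (simp add: vertex_triangle_2_club_def)
qed

text \<open>Lowering the threshold enlarges the vertex set and weakens the demand, so the admissible
  thresholds form an initial segment. This bounds \<open>X\<close>, at threshold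
  \<open>k + 1\<close>, and lets the program find the h-index by counting thresholds.\<close>

lemma h_index_bound:
  assumes "pair_graph G"
  defines "d \<equiv> out_degree (with_proj G)"
  shows "k \<le> h_index G \<longleftrightarrow> k \<le> card {v \<in> pverts G. k \<le> d v}"
proof -
  interpret pair_graph G by fact
  let ?A = "{k. k \<le> card {v \<in> pverts G. k \<le> d v}}"
  have "?A \<subseteq> {..card (pverts G)}"
    using card_mono[OF pair_finite_verts] by (auto intro: order_trans[OF _ card_mono[OF pair_finite_verts]])
  then have fin: "finite ?A" by (rule finite_subset) simp
  have "0 \<in> ?A" by simp
  then have "h_index G \<in> ?A" unfolding h_index_def d_def[symmetric] using fin by (intro Max_in) auto
  moreover have "k \<in> ?A" if "h \<in> ?A" "k \<le> h" for h
  proof -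
    have "{v \<in> pverts G. h \<le> d v} \<subseteq> {v \<in> pverts G. k \<le> d v}" using that(2) by auto
    then have "card {v \<in> pverts G. h \<le> d v} \<le> card {v \<in> pverts G. k \<le> d v}"
      by (intro card_mono) auto
    with that show ?thesis by simp
  qed
  moreover have "k \<le> h_index G" if "k \<in> ?A"
    unfolding h_index_def d_def[symmetric] using fin that by (rule Max_ge)
  ultimately show ?thesis by blast
qed

lemma out_degree_with_proj: "out_degree (with_proj G) v = card {w. (v, w) \<in> parcs G}"
proof -
  have "out_arcs (with_proj G) v = Pair v ` {w. (v, w) \<in> parcs G}"
    by (auto simp: out_arcs_def)
  then show ?thesis by (simp add: out_degree_def card_image inj_on_def)
qed

section \<open>Timed execution\<close>

text \<open>Total correctness with a time budget; \<open>T\<close> is only an upper bound, so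
  budgets can be relaxed and added freely.\<close>

definition runs :: "com \<Rightarrow> state \<Rightarrow> nat \<Rightarrow> (state \<Rightarrow> bool) \<Rightarrow> bool" where
  "runs c s T Q \<longleftrightarrow> (\<exists>t \<le> T. \<exists>s'. exec c s t s' \<and> Q s')"

lemma runs_mono:
  assumes "runs c s T Q" "T \<le> T'" "\<And>s'. Q s' \<Longrightarrow> Q' s'"
  shows "runs c s T' Q'"
  using assms unfolding runs_def by (meson order_trans)

lemma runs_Write:
  assumes "cost a + cost b + 1 \<le> T" "Q (s(x := (s x)(val a s := val b s)))"
  shows "runs (Write x a b) s T Q"
  using assms exec.Write unfolding runs_def by blast

lemma runs_Seq:
  assumes "runs c s T1 P" "\<And>s'. P s' \<Longrightarrow> runs d s' T2 Q" "T1 + T2 \<le> T"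
  shows "runs (Seq c d) s T Q"
proof -
  from assms(1) obtain t s' where 1: "t \<le> T1" "exec c s t s'" "P s'"
    unfolding runs_def by blast
  from assms(2)[OF 1(3)] obtain u s'' where 2: "u \<le> T2" "exec d s' u s''" "Q s''"
    unfolding runs_def by blast
  from exec.Seq[OF 1(2) 2(2)] have "exec (Seq c d) s (t + u) s''" .
  moreover have "t + u \<le> T" using 1(1) 2(1) assms(3) by simp
  ultimately show ?thesis using 2(3) unfolding runs_def by blast
qed

lemma runs_Seq_Write:
  assumes "runs d (s(x := (s x)(val a s := val b s))) T2 Q" "cost a + cost b + 1 + T2 \<le> T"
  shows "runs (Seq (Write x a b) d) s T Q"
  by (rule runs_Seq[OF runs_Write[where Q="(=) (s(x := (s x)(val a s := val b s)))"]])
    (use assms in auto)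

lemma runs_If:
  assumes "val b s \<noteq> 0 \<Longrightarrow> runs c s T Q" "val b s = 0 \<Longrightarrow> runs d s T Q"
  shows "runs (If b c d) s (cost b + 1 + T) Q"
proof (cases "val b s = 0")
  case True
  then show ?thesis
    using assms(2) exec.IfFalse unfolding runs_def by (meson add_le_cancel_left)
next
  case False
  then show ?thesis
    using assms(1) exec.IfTrue unfolding runs_def by (meson add_le_cancel_left)
qed

text \<open>The invariant is indexed by the number of remaining iterations and thereby serves as the
  termination measure as well.\<close>

lemma runs_While:
  assumes "I n s"
    and step: "\<And>j s. I (Suc j) s \<Longrightarrow> val b s \<noteq> 0 \<and> runs c s T (I j)"
    and stop: "\<And>s. I 0 s \<Longrightarrow> val b s = 0"
  shows "runs (While b c) s (n * (cost b + 1 + T) + cost b + 1) (I 0)"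
  using assms(1)
proof (induction n arbitrary: s)
  case 0
  then show ?case using exec.WhileFalse[of b s c] stop unfolding runs_def by auto
next
  case (Suc n)
  from step[OF Suc.prems] obtain t s' where
    1: "val b s \<noteq> 0" "t \<le> T" "exec c s t s'" "I n s'"
    unfolding runs_def by blast
  from Suc.IH[OF 1(4)] obtain u s'' where
    2: "u \<le> n * (cost b + 1 + T) + cost b + 1" "exec (While b c) s' u s''" "I 0 s''"
    unfolding runs_def by blast
  from exec.WhileTrue[OF 1(1,3) 2(2)]
  have "exec (While b c) s (cost b + 1 + t + u) s''" .
  moreover have "cost b + 1 + t + u \<le> Suc n * (cost b + 1 + T) + cost b + 1"
    using 1(2) 2(1) by simp
  ultimately show ?case using 2(3) unfolding runs_def by blast
qed

section \<open>Terms with bounded sums\<close>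

text \<open>The arrays owned by compiled code: loop variables, accumulators, results, the update
  buffer and the counters of \<open>Rep\<close>.\<close>

definition scratch :: "string set" where
  "scratch = {''var'', ''acc'', ''res'', ''tmp'', ''ctr''}"

definition agree :: "state \<Rightarrow> state \<Rightarrow> bool" where
  "agree s s' \<longleftrightarrow> (\<forall>y. y \<notin> scratch \<longrightarrow> s y = s' y)"

text \<open>Bounded sums are the only iteration, which suffices for counting and for bounded
  quantifiers.\<close>

datatype tm =
    Ret expr
  | SumT expr tm
  | IfT tm tm tm
  | GeT tm expr

text \<open>Variables are de Bruijn levels: the variable of the \<open>d\<close>-th enclosing sum is cell \<open>d\<close> of \<open>var\<close>.\<close>

primrec eval :: "tm \<Rightarrow> nat \<Rightarrow> (nat \<Rightarrow> nat) \<Rightarrow> state \<Rightarrow> nat" where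
  "eval (Ret e) d \<rho> s = val e (s(''var'' := \<rho>))"
| "eval (SumT b t) d \<rho> s = (\<Sum>i<val b s. eval t (Suc d) (\<rho>(d := i)) s)"
| "eval (IfT c a b) d \<rho> s = (if eval c d \<rho> s \<noteq> 0 then eval a d \<rho> s else eval b d \<rho> s)"
| "eval (GeT t e) d \<rho> s = (if val e (s(''var'' := \<rho>)) \<le> eval t d \<rho> s then 1 else 0)"

text \<open>Loop variables are readable only at a literal level below \<open>d\<close>, and no other
  scratch array at all. A value thus depends on \<open>d\<close> variables and ordinary memory
  alone.\<close>

primrec wf_expr :: "nat \<Rightarrow> expr \<Rightarrow> bool" where
  "wf_expr d (Const m) = True"
| "wf_expr d (Read x a) =
    (if x = ''var'' then (\<exists>i<d. a = Const i) else x \<notin> scratch \<and> wf_expr d a)"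
| "wf_expr d (Plus a b) = (wf_expr d a \<and> wf_expr d b)"
| "wf_expr d (Minus a b) = (wf_expr d a \<and> wf_expr d b)"

text \<open>The bound of a sum must be closed: it cannot mention enclosing loop variables, so one
  number limits all of its evaluations.\<close>

primrec wf_tm :: "tm \<Rightarrow> nat \<Rightarrow> bool" where
  "wf_tm (Ret e) d = wf_expr d e"
| "wf_tm (SumT b t) d = (wf_expr 0 b \<and> wf_tm t (Suc d))"
| "wf_tm (IfT c a b) d = (wf_tm c d \<and> wf_tm a d \<and> wf_tm b d)"
| "wf_tm (GeT t e) d = (wf_tm t d \<and> wf_expr d e)"

lemma val_cong:
  assumes "wf_expr d e" "agree s s'" "\<And>i. i < d \<Longrightarrow> s ''var'' i = s' ''var'' i"
  shows "val e s = val e s'"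
  using assms by (induction e) (auto simp: agree_def split: if_splits)

lemma agree_var [simp]: "agree (s(''var'' := \<rho>)) s' \<longleftrightarrow> agree s s'"
  "agree s (s'(''var'' := \<rho>)) \<longleftrightarrow> agree s s'"
  by (auto simp: agree_def scratch_def)

lemma val_closed:
  assumes "wf_expr 0 e" "agree s s'"
  shows "val e s = val e s'"
  using val_cong assms by blast

lemma eval_cong:
  assumes "wf_tm t d" "agree s s'" "\<And>i. i < d \<Longrightarrow> \<rho> i = \<rho>' i"
  shows "eval t d \<rho> s = eval t d \<rho>' s'"
  using assms
proof (induction t arbitrary: d \<rho> \<rho>')
  case (Ret e)
  then show ?case by (auto intro!: val_cong[of d])
next
  case (SumT b t)
  have "val b s = val b s'" using SumT.prems val_closed by auto
  moreover have "eval t (Suc d) (\<rho>(d := i)) s = eval t (Suc d) (\<rho>'(d := i)) s'" for i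
    using SumT.prems by (intro SumT.IH) auto
  ultimately show ?case by simp
next
  case (IfT c a b)
  then show ?case by (simp; metis)
next
  case (GeT t e)
  have "val e (s(''var'' := \<rho>)) = val e (s'(''var'' := \<rho>'))"
    using GeT.prems by (intro val_cong[of d]) auto
  with GeT show ?case by (simp; metis)
qed

abbreviation var :: "nat \<Rightarrow> expr" where "var d \<equiv> Read ''var'' (Const d)"
abbreviation cell :: "string \<Rightarrow> expr" where "cell x \<equiv> Read x (Const 0)"

text \<open>Loops count down in cell \<open>d\<close> of \<open>var\<close>, and inner terms use
  higher levels only. By truncated subtraction, \<open>1 - (e - res)\<close> is 1 exactly if
  \<open>e \<le> res\<close>.\<close>

primrec compile :: "tm \<Rightarrow> nat \<Rightarrow> com" where
  "compile (Ret e) d = Write ''res'' (Const 0) e"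
| "compile (SumT b t) d =
    Seq (Write ''acc'' (Const d) (Const 0))
   (Seq (Write ''var'' (Const d) b)
   (Seq (While (var d)
          (Seq (Write ''var'' (Const d) (Minus (var d) (Const 1)))
          (Seq (compile t (Suc d))
               (Write ''acc'' (Const d) (Plus (Read ''acc'' (Const d)) (cell ''res''))))))
        (Write ''res'' (Const 0) (Read ''acc'' (Const d)))))"
| "compile (IfT c a b) d =
    Seq (compile c d) (If (cell ''res'') (compile a d) (compile b d))"
| "compile (GeT t e) d =
    Seq (compile t d) (Write ''res'' (Const 0) (Minus (Const 1) (Minus e (cell ''res''))))"

primrec bounds :: "tm \<Rightarrow> expr set" where
  "bounds (Ret e) = {}"
| "bounds (SumT b t) = insert b (bounds t)"
| "bounds (IfT c a b) = bounds c \<union> bounds a \<union> bounds b"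
| "bounds (GeT t e) = bounds t"

lemma bounds_closed: "wf_tm t d \<Longrightarrow> b \<in> bounds t \<Longrightarrow> wf_expr 0 b"
  by (induction t arbitrary: d) auto

text \<open>\<open>N\<close> limits all loop bounds. Both branches of \<open>IfT\<close> are
  charged, which avoids a maximum and keeps the cost a polynomial.\<close>

primrec tcost :: "tm \<Rightarrow> nat \<Rightarrow> nat" where
  "tcost (Ret e) N = cost e + 2"
| "tcost (SumT b t) N = cost b + 12 + N * (tcost t N + 16)"
| "tcost (IfT c a b) N = tcost c N + tcost a N + tcost b N + 3"
| "tcost (GeT t e) N = tcost t N + cost e + 7"

text \<open>Preserving the levels below \<open>d\<close> is what protects the enclosing
  loops.\<close>

definition yields :: "nat \<Rightarrow> nat \<Rightarrow> state \<Rightarrow> state \<Rightarrow> bool" where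
  "yields d v s s' \<longleftrightarrow> s' ''res'' 0 = v \<and> (\<forall>y. y \<notin> {''var'', ''acc'', ''res''} \<longrightarrow> s' y = s y) \<and>
    (\<forall>i<d. s' ''var'' i = s ''var'' i \<and> s' ''acc'' i = s ''acc'' i)"

lemma yields_agree: "yields d v s s' \<Longrightarrow> agree s s'"
  unfolding yields_def agree_def scratch_def by auto

lemma runs_compile:
  assumes "wf_tm t d" "\<And>b. b \<in> bounds t \<Longrightarrow> val b s \<le> N"
  shows "runs (compile t d) s (tcost t N) (yields d (eval t d (s ''var'') s) s)"
  using assms
proof (induction t arbitrary: d s)
  case (Ret e)
  show ?case by (auto intro!: runs_Write simp: yields_def)
next
  case (SumT b t)
  let ?f = "\<lambda>i. eval t (Suc d) ((s ''var'')(d := i)) s"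
  let ?n = "val b s"
  \<comment> \<open>The loop counts down, so the indices already summed are those from
    \<open>j\<close> upwards.\<close>
  define I where "I j s' \<longleftrightarrow> s' ''var'' d = j \<and> s' ''acc'' d = (\<Sum>i\<in>{j..<?n}. ?f i) \<and>
      j \<le> ?n \<and> (\<forall>y. y \<notin> {''var'', ''acc'', ''res''} \<longrightarrow> s' y = s y) \<and>
      (\<forall>i<d. s' ''var'' i = s ''var'' i \<and> s' ''acc'' i = s ''acc'' i)" for j s'
  let ?s0 = "s(''acc'' := (s ''acc'')(d := 0))"
  let ?s1 = "?s0(''var'' := (?s0 ''var'')(d := ?n))"
  have b: "val b ?s0 = ?n"
    using SumT.prems by (intro val_closed) (auto simp: agree_def scratch_def)
  have I1: "I ?n ?s1" by (auto simp: I_def)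
  have step: "val (var d) s' \<noteq> 0 \<and>
    runs (Seq (Write ''var'' (Const d) (Minus (var d) (Const 1)))
          (Seq (compile t (Suc d))
               (Write ''acc'' (Const d) (Plus (Read ''acc'' (Const d)) (cell ''res'')))))
      s' (tcost t N + 13) (I j)" if I: "I (Suc j) s'" for j s'
  proof -
    let ?s2 = "s'(''var'' := (s' ''var'')(d := j))"
    have ag: "agree s ?s2" using I by (auto simp: I_def agree_def scratch_def)
    have bnd: "val e ?s2 \<le> N" if "e \<in> bounds t" for e
    proof -
      have "wf_tm t (Suc d)" using SumT.prems(1) by simp
      from val_closed[OF bounds_closed[OF this that] ag] SumT.prems(2)[of e] that
      show ?thesis by simp
    qed
    \<comment> \<open>The body starts with altered scratch arrays, but its value depends only on
      ordinary memory and the first \<open>Suc d\<close> variables.\<close>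
    have "eval t (Suc d) (?s2 ''var'') ?s2 = ?f j"
      using SumT.prems I ag by (intro eval_cong) (auto simp: I_def less_Suc_eq agree_def)
    moreover have "runs (compile t (Suc d)) ?s2 (tcost t N)
        (yields (Suc d) (eval t (Suc d) (?s2 ''var'') ?s2) ?s2)"
      by (rule SumT.IH[OF _ bnd]) (use SumT.prems in simp_all)
    ultimately have r: "runs (compile t (Suc d)) ?s2 (tcost t N) (yields (Suc d) (?f j) ?s2)"
      by simp
    have sum: "(\<Sum>i\<in>{j..<?n}. ?f i) = ?f j + (\<Sum>i\<in>{Suc j..<?n}. ?f i)"
      using I by (intro sum.atLeast_Suc_lessThan) (auto simp: I_def)
    have body: "runs (Seq (compile t (Suc d))
               (Write ''acc'' (Const d) (Plus (Read ''acc'' (Const d)) (cell ''res''))))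
         ?s2 (tcost t N + 7) (I j)"
    proof (rule runs_Seq[OF r])
      fix s4 assume y: "yields (Suc d) (?f j) ?s2 s4"
      show "runs (Write ''acc'' (Const d) (Plus (Read ''acc'' (Const d)) (cell ''res''))) s4 7 (I j)"
      proof (rule runs_Write)
        show "I j (s4(''acc'' := (s4 ''acc'')
          (val (Const d) s4 := val (Plus (Read ''acc'' (Const d)) (cell ''res'')) s4)))"
          using I y sum unfolding I_def yields_def by auto
      qed simp
    qed simp
    have "val (var d) s' \<noteq> 0" using I by (simp add: I_def)
    moreover have "runs (Seq (Write ''var'' (Const d) (Minus (var d) (Const 1)))
          (Seq (compile t (Suc d))
               (Write ''acc'' (Const d) (Plus (Read ''acc'' (Const d)) (cell ''res'')))))
      s' (tcost t N + 13) (I j)"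
    proof (rule runs_Seq_Write)
      have "(s' ''var'')(val (Const d) s' := val (Minus (var d) (Const 1)) s') = (s' ''var'')(d := j)"
        using I unfolding I_def by simp
      with body show "runs (Seq (compile t (Suc d))
          (Write ''acc'' (Const d) (Plus (Read ''acc'' (Const d)) (cell ''res''))))
        (s'(''var'' := (s' ''var'')(val (Const d) s' := val (Minus (var d) (Const 1)) s')))
        (tcost t N + 7) (I j)" by simp
    qed simp
    ultimately show ?thesis ..
  qed
  have loop: "runs (While (var d) (Seq (Write ''var'' (Const d) (Minus (var d) (Const 1)))
          (Seq (compile t (Suc d))
               (Write ''acc'' (Const d) (Plus (Read ''acc'' (Const d)) (cell ''res''))))))
      ?s1 (?n * (cost (var d) + 1 + (tcost t N + 13)) + cost (var d) + 1) (I 0)"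
    by (rule runs_While[where I=I, OF I1 step]) (auto simp: I_def)
  have "?n * (tcost t N + 16) \<le> N * (tcost t N + 16)"
    using SumT.prems(2)[of b] by (intro mult_right_mono) simp_all
  then have time: "?n * (cost (var d) + 1 + (tcost t N + 13)) + cost (var d) + 1 + 4
      \<le> N * (tcost t N + 16) + 7" by (simp add: algebra_simps)
  have last: "runs (Write ''res'' (Const 0) (Read ''acc'' (Const d))) s' 4
      (yields d (eval (SumT b t) d (s ''var'') s) s)" if "I 0 s'" for s'
    using that by (intro runs_Write) (auto simp: I_def yields_def lessThan_atLeast0)
  have "runs (compile (SumT b t) d) s (3 + (cost b + 2 + (7 + N * (tcost t N + 16))))
      (yields d (eval (SumT b t) d (s ''var'') s) s)"
    unfolding compile.simps
  proof (intro runs_Seq_Write)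
    show "runs (Seq (While (var d) (Seq (Write ''var'' (Const d) (Minus (var d) (Const 1)))
          (Seq (compile t (Suc d))
               (Write ''acc'' (Const d) (Plus (Read ''acc'' (Const d)) (cell ''res''))))))
        (Write ''res'' (Const 0) (Read ''acc'' (Const d))))
      (s(''acc'' := (s ''acc'')(val (Const d) s := val (Const 0) s),
         ''var'' := ((s(''acc'' := (s ''acc'')(val (Const d) s := val (Const 0) s))) ''var'')
           (val (Const d) (s(''acc'' := (s ''acc'')(val (Const d) s := val (Const 0) s))) :=
            val b (s(''acc'' := (s ''acc'')(val (Const d) s := val (Const 0) s))))))
      (7 + N * (tcost t N + 16)) (yields d (eval (SumT b t) d (s ''var'') s) s)"
      unfolding val.simps b by (rule runs_Seq[OF loop last]) (use time in simp_all)
  qed (rule order_refl, simp)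
  then show ?case by (rule runs_mono) simp_all
next
  case (IfT c a b)
  let ?\<rho> = "s ''var''"
  have "runs (If (cell ''res'') (compile a d) (compile b d)) s'
      (3 + (tcost a N + tcost b N)) (yields d (eval (IfT c a b) d ?\<rho> s) s)"
    if y: "yields d (eval c d ?\<rho> s) s s'" for s'
  proof -
    have branch: "runs (compile u d) s' (tcost a N + tcost b N) (yields d (eval u d ?\<rho> s) s)"
      if u: "u \<in> {a, b}" for u
    proof -
      have wf: "wf_tm u d" using u IfT.prems(1) by auto
      have bnd: "val e s' \<le> N" if "e \<in> bounds u" for e
        using val_closed[OF bounds_closed[OF wf that] yields_agree[OF y]]
          IfT.prems(2)[of e] that u by auto
      have "eval u d (s' ''var'') s' = eval u d ?\<rho> s"
        using eval_cong[OF wf yields_agree[OF y], of ?\<rho> "s' ''var''"] y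
        by (simp add: yields_def)
      moreover have "runs (compile u d) s' (tcost u N) (yields d (eval u d (s' ''var'') s') s')"
        using u IfT.IH(2)[OF _ bnd] IfT.IH(3)[OF _ bnd] wf by auto
      ultimately have "runs (compile u d) s' (tcost u N) (yields d (eval u d ?\<rho> s) s')" by simp
      then show ?thesis
      proof (rule runs_mono)
        show "tcost u N \<le> tcost a N + tcost b N" using u by auto
        fix s'' assume "yields d (eval u d ?\<rho> s) s' s''"
        then show "yields d (eval u d ?\<rho> s) s s''" using y by (simp add: yields_def)
      qed
    qed
    have "runs (If (cell ''res'') (compile a d) (compile b d)) s'
        (cost (cell ''res'') + 1 + (tcost a N + tcost b N)) (yields d (eval (IfT c a b) d ?\<rho> s) s)"
      using y branch by (intro runs_If) (auto simp: yields_def)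
    then show ?thesis by (simp add: eval_nat_numeral)
  qed
  note branches = this
  have "runs (compile c d) s (tcost c N) (yields d (eval c d ?\<rho> s) s)"
    using IfT.prems by (intro IfT.IH(1)) simp_all
  from runs_Seq[OF this branches order_refl] show ?case
    unfolding compile.simps by (rule runs_mono) simp_all
next
  case (GeT t e)
  let ?v = "eval t d (s ''var'') s"
  have "runs (Write ''res'' (Const 0) (Minus (Const 1) (Minus e (cell ''res'')))) s'
      (cost e + 7) (yields d (eval (GeT t e) d (s ''var'') s) s)" if y: "yields d ?v s s'" for s'
  proof -
    have "val e s' = val e s"
      using val_cong[of d e s s'] GeT.prems yields_agree[OF y] y by (simp add: yields_def)
    then show ?thesis using y by (intro runs_Write) (auto simp: yields_def)
  qed
  note last = this
  have "runs (compile t d) s (tcost t N) (yields d ?v s)"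
    using GeT.prems by (intro GeT.IH) simp_all
  from runs_Seq[OF this last order_refl] show ?case
    unfolding compile.simps by (rule runs_mono) simp_all
qed

section \<open>Loop programs\<close>

text \<open>\<open>Rep\<close> fixes its count on entry, so every program terminates and
  \<open>sem\<close> is a plain function.\<close>

datatype prog =
    Upd string expr tm
  | Then prog prog
  | Rep expr prog

primrec sem :: "prog \<Rightarrow> state \<Rightarrow> state" where
  "sem (Upd a b t) s = s(a := \<lambda>i. if i < val b s then eval t 1 (\<lambda>_. i) s else s a i)"
| "sem (Then p q) s = sem q (sem p s)"
| "sem (Rep b p) s = (sem p ^^ val b s) s"

primrec wf_prog :: "prog \<Rightarrow> bool" where
  "wf_prog (Upd a b t) \<longleftrightarrow> a \<notin> scratch \<and> wf_expr 0 b \<and> wf_tm t 1"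
| "wf_prog (Then p q) \<longleftrightarrow> wf_prog p \<and> wf_prog q"
| "wf_prog (Rep b p) \<longleftrightarrow> wf_expr 0 b \<and> wf_prog p"

text \<open>An update goes through the array \<open>tmp\<close>, so that all cells are computed from the old state.\<close>

primrec compile_prog :: "prog \<Rightarrow> nat \<Rightarrow> com" where
  "compile_prog (Upd a b t) d =
    Seq (Write ''var'' (Const 0) b)
   (Seq (While (var 0)
          (Seq (Write ''var'' (Const 0) (Minus (var 0) (Const 1)))
          (Seq (compile t 1) (Write ''tmp'' (var 0) (cell ''res'')))))
   (Seq (Write ''var'' (Const 0) b)
        (While (var 0)
          (Seq (Write ''var'' (Const 0) (Minus (var 0) (Const 1)))
               (Write a (var 0) (Read ''tmp'' (var 0)))))))"
| "compile_prog (Then p q) d = Seq (compile_prog p d) (compile_prog q d)"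
| "compile_prog (Rep b p) d =
    Seq (Write ''ctr'' (Const d) b)
        (While (Read ''ctr'' (Const d))
          (Seq (compile_prog p (Suc d))
               (Write ''ctr'' (Const d) (Minus (Read ''ctr'' (Const d)) (Const 1)))))"

text \<open>\<open>s\<close> is the state predicted by \<open>sem\<close> and \<open>s'\<close> the
  one reached. The counters below \<open>d\<close> belong to the enclosing \<open>Rep\<close> loops
  and must survive.\<close>

definition simulates :: "nat \<Rightarrow> state \<Rightarrow> state \<Rightarrow> state \<Rightarrow> bool" where
  "simulates d s s0 s' \<longleftrightarrow> agree s s' \<and> (\<forall>i<d. s' ''ctr'' i = s0 ''ctr'' i)"

definition takes :: "prog \<Rightarrow> nat \<Rightarrow> state \<Rightarrow> nat \<Rightarrow> bool" where
  "takes p d s T \<longleftrightarrow> (\<forall>s0. agree s s0 \<longrightarrow> runs (compile_prog p d) s0 T (simulates d (sem p s) s0))"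

lemma agree_trans: "agree s s' \<Longrightarrow> agree s' s'' \<Longrightarrow> agree s s''"
  by (auto simp: agree_def)

lemma takes_mono: "takes p d s T \<Longrightarrow> T \<le> T' \<Longrightarrow> takes p d s T'"
  unfolding takes_def by (blast intro: runs_mono)

lemma takes_Then:
  assumes "takes p d s T1" "takes q d (sem p s) T2"
  shows "takes (Then p q) d s (T1 + T2)"
  unfolding takes_def compile_prog.simps sem.simps
proof (intro allI impI, rule runs_Seq[OF _ _ order_refl])
  fix s0 assume s0: "agree s s0"
  show "runs (compile_prog p d) s0 T1 (simulates d (sem p s) s0)"
    using assms(1) s0 unfolding takes_def by blast
  fix s' assume s': "simulates d (sem p s) s0 s'"
  then have "runs (compile_prog q d) s' T2 (simulates d (sem q (sem p s)) s')"
    using assms(2) unfolding takes_def simulates_def by blast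
  then show "runs (compile_prog q d) s' T2 (simulates d (sem q (sem p s)) s0)"
    by (rule runs_mono) (use s' in \<open>auto simp: simulates_def\<close>)
qed

text \<open>The body is timed only on states that the iteration visits, so an invariant of the
  trajectory may be used to bound it.\<close>

lemma takes_Rep:
  assumes b: "wf_expr 0 b"
    and step: "\<And>i. i < val b s \<Longrightarrow> takes p (Suc d) ((sem p ^^ i) s) T"
  shows "takes (Rep b p) d s (val b s * (T + 9) + cost b + 5)"
  unfolding takes_def compile_prog.simps sem.simps
proof (intro allI impI)
  fix s0 assume s0: "agree s s0"
  let ?n = "val b s"
  let ?s1 = "s0(''ctr'' := (s0 ''ctr'')(d := ?n))"
  define I where "I j s' \<longleftrightarrow> j \<le> ?n \<and> s' ''ctr'' d = j \<and> simulates d ((sem p ^^ (?n - j)) s) s0 s'"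
    for j s'
  have val: "val b s0 = ?n" using val_closed[OF b s0] by simp
  have I1: "I ?n ?s1"
    using s0 unfolding I_def simulates_def agree_def scratch_def by simp
  have body: "val (Read ''ctr'' (Const d)) s' \<noteq> 0 \<and>
      runs (Seq (compile_prog p (Suc d))
               (Write ''ctr'' (Const d) (Minus (Read ''ctr'' (Const d)) (Const 1)))) s' (T + 6) (I j)"
    if I: "I (Suc j) s'" for j s'
  proof
    show "val (Read ''ctr'' (Const d)) s' \<noteq> 0" using I by (simp add: I_def)
    let ?u = "(sem p ^^ (?n - Suc j)) s"
    have eq: "?n - j = Suc (?n - Suc j)" using I unfolding I_def by linarith
    have "takes p (Suc d) ?u T" using I by (intro step) (simp add: I_def)
    moreover have "agree ?u s'" using I by (simp add: I_def simulates_def)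
    ultimately have r: "runs (compile_prog p (Suc d)) s' T (simulates (Suc d) (sem p ?u) s')"
      unfolding takes_def by blast
    show "runs (Seq (compile_prog p (Suc d))
               (Write ''ctr'' (Const d) (Minus (Read ''ctr'' (Const d)) (Const 1)))) s' (T + 6) (I j)"
    proof (rule runs_Seq[OF r])
      fix s'' assume s'': "simulates (Suc d) (sem p ?u) s' s''"
      show "runs (Write ''ctr'' (Const d) (Minus (Read ''ctr'' (Const d)) (Const 1))) s'' 6 (I j)"
        by (rule runs_Write)
          (use I s'' in \<open>auto simp: I_def simulates_def agree_def scratch_def eq less_Suc_eq\<close>)
    qed simp
  qed
  have loop: "runs (While (Read ''ctr'' (Const d)) (Seq (compile_prog p (Suc d))
               (Write ''ctr'' (Const d) (Minus (Read ''ctr'' (Const d)) (Const 1))))) ?s1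
      (?n * (cost (Read ''ctr'' (Const d)) + 1 + (T + 6)) + cost (Read ''ctr'' (Const d)) + 1) (I 0)"
    by (rule runs_While[where I=I, OF I1 body]) (auto simp: I_def)
  show "runs (Seq (Write ''ctr'' (Const d) b) (While (Read ''ctr'' (Const d))
          (Seq (compile_prog p (Suc d))
               (Write ''ctr'' (Const d) (Minus (Read ''ctr'' (Const d)) (Const 1))))))
      s0 (?n * (T + 9) + cost b + 5) (simulates d ((sem p ^^ ?n) s) s0)"
    by (rule runs_Seq_Write, unfold val val.simps, rule runs_mono[OF loop order_refl])
      (auto simp: I_def algebra_simps)
qed

definition upd_cost :: "expr \<Rightarrow> tm \<Rightarrow> nat \<Rightarrow> nat" where
  "upd_cost b t N = 2 * cost b + 12 + N * (tcost t N + 40)"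

lemma takes_Upd:
  assumes wf: "wf_prog (Upd a b t)" and bnd: "\<And>e. e \<in> insert b (bounds t) \<Longrightarrow> val e s \<le> N"
  shows "takes (Upd a b t) d s (upd_cost b t N)"
  unfolding takes_def compile_prog.simps sem.simps
proof (intro allI impI)
  fix s0 assume s0: "agree s s0"
  let ?n = "val b s" and ?f = "\<lambda>i. eval t 1 (\<lambda>_. i) s"
  have a: "a \<notin> scratch" and b: "wf_expr 0 b" and t: "wf_tm t 1" using wf by auto
  define W1 where "W1 = While (var 0)
          (Seq (Write ''var'' (Const 0) (Minus (var 0) (Const 1)))
          (Seq (compile t 1) (Write ''tmp'' (var 0) (cell ''res''))))"
  define W2 where "W2 = While (var 0)
          (Seq (Write ''var'' (Const 0) (Minus (var 0) (Const 1)))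
               (Write a (var 0) (Read ''tmp'' (var 0))))"
  \<comment> \<open>Both loops run downwards: \<open>I\<close> says that \<open>tmp\<close> is
    filled from \<open>j\<close> upwards, and \<open>J\<close> below that \<open>a\<close> has been
    overwritten from \<open>j\<close> upwards.\<close>
  define I where "I j s' \<longleftrightarrow> j \<le> ?n \<and> s' ''var'' 0 = j \<and> (\<forall>i\<in>{j..<?n}. s' ''tmp'' i = ?f i) \<and>
      simulates d s s0 s'" for j s'
  define J where "J j s' \<longleftrightarrow> j \<le> ?n \<and> s' ''var'' 0 = j \<and> (\<forall>i<?n. s' ''tmp'' i = ?f i) \<and>
      simulates d (s(a := \<lambda>i. if j \<le> i \<and> i < ?n then ?f i else s a i)) s0 s'" for j s'
  have n: "?n \<le> N" using bnd by simp
  have val: "val b s' = ?n" if "agree s s'" for s' using val_closed[OF b that] by simp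
  have dec: "runs (Seq (Write ''var'' (Const 0) (Minus (var 0) (Const 1))) c) s' (T + 6) Q"
    if "s' ''var'' 0 = Suc j" "runs c (s'(''var'' := (s' ''var'')(0 := j))) T Q" for c s' T Q j
    by (rule runs_Seq_Write[where ?T2.0 = T]) (use that in auto)
  have loop1: "runs W1 s' (?n * (tcost t N + 16) + 3) (I 0)" if "I ?n s'" for s'
  proof -
    have "val (var 0) s' \<noteq> 0 \<and> runs (Seq (Write ''var'' (Const 0) (Minus (var 0) (Const 1)))
          (Seq (compile t 1) (Write ''tmp'' (var 0) (cell ''res'')))) s' (tcost t N + 6 + 6) (I j)"
      if I: "I (Suc j) s'" for j s'
    proof
      show "val (var 0) s' \<noteq> 0" using I by (simp add: I_def)
      let ?s2 = "s'(''var'' := (s' ''var'')(0 := j))"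
      have ag: "agree s ?s2" using I by (simp add: I_def simulates_def)
      have bnd2: "val e ?s2 \<le> N" if "e \<in> bounds t" for e
        using val_closed[OF bounds_closed[OF t that] ag] bnd[of e] that by simp
      have "eval t 1 (?s2 ''var'') ?s2 = ?f j"
        using eval_cong[OF t ag, of "\<lambda>_. j" "?s2 ''var''"] by simp
      then have r: "runs (compile t 1) ?s2 (tcost t N) (yields 1 (?f j) ?s2)"
        using runs_compile[OF t bnd2] by simp
      have "runs (Seq (compile t 1) (Write ''tmp'' (var 0) (cell ''res''))) ?s2 (tcost t N + 6) (I j)"
      proof (rule runs_Seq[OF r])
        fix s'' assume y: "yields 1 (?f j) ?s2 s''"
        then have v: "s'' ''var'' 0 = j" "s'' ''res'' 0 = ?f j" "s'' ''tmp'' = s' ''tmp''"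
          "s'' ''ctr'' = s' ''ctr''" "agree s s''"
          using agree_trans[OF ag yields_agree[OF y]] by (simp_all add: yields_def)
        have "I j (s''(''tmp'' := (s'' ''tmp'')(j := ?f j)))"
          using I v unfolding I_def simulates_def agree_def scratch_def by auto
        then show "runs (Write ''tmp'' (var 0) (cell ''res'')) s'' 6 (I j)"
          by (intro runs_Write) (use v in simp_all)
      qed simp
      then show "runs (Seq (Write ''var'' (Const 0) (Minus (var 0) (Const 1)))
          (Seq (compile t 1) (Write ''tmp'' (var 0) (cell ''res'')))) s' (tcost t N + 6 + 6) (I j)"
        using I by (intro dec) (simp_all add: I_def)
    qed
    from runs_While[where I=I, OF \<open>I ?n s'\<close> this] show ?thesis
      unfolding W1_def by (rule runs_mono) (auto simp: I_def algebra_simps)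
  qed
  have loop2: "runs W2 s' (?n * 20 + 3) (J 0)" if "J ?n s'" for s'
  proof -
    have "val (var 0) s' \<noteq> 0 \<and> runs (Seq (Write ''var'' (Const 0) (Minus (var 0) (Const 1)))
          (Write a (var 0) (Read ''tmp'' (var 0)))) s' (10 + 6) (J j)"
      if J: "J (Suc j) s'" for j s'
    proof
      show "val (var 0) s' \<noteq> 0" using J by (simp add: J_def)
      let ?s2 = "s'(''var'' := (s' ''var'')(0 := j))"
      have neq: "a \<noteq> ''var''" "a \<noteq> ''tmp''" "a \<noteq> ''ctr''" using a by (auto simp: scratch_def)
      let ?g = "\<lambda>k i. if k \<le> i \<and> i < ?n then ?f i else s a i"
      have j: "j < ?n" and ag: "agree (s(a := ?g (Suc j))) s'"
        using J by (simp_all add: J_def simulates_def)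
      then have "s' a = ?g (Suc j)" using a unfolding agree_def by (auto dest: spec[of _ a])
      then have "(?s2 a)(j := ?f j) = (?g (Suc j))(j := ?f j)" using neq by simp
      also have "\<dots> = ?g j" by (rule ext) (use j in \<open>simp add: Suc_le_eq le_less\<close>)
      finally have "(?s2 a)(j := ?f j) = ?g j" .
      moreover have "agree (s(a := ?g j)) (?s2(a := ?g j))"
      proof -
        have "agree (u(a := h)) (u'(a := h))" if "agree (u(a := g)) u'" for u u' g h
          using that by (auto simp: agree_def)
        from this[OF ag] show ?thesis using neq by (simp add: fun_upd_twist)
      qed
      ultimately have "J j (?s2(a := (?s2 a)(j := ?f j)))"
        using J neq unfolding J_def simulates_def by simp
      then have "runs (Write a (var 0) (Read ''tmp'' (var 0))) ?s2 10 (J j)"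
        by (intro runs_Write) (use J in \<open>simp_all add: J_def\<close>)
      then show "runs (Seq (Write ''var'' (Const 0) (Minus (var 0) (Const 1)))
          (Write a (var 0) (Read ''tmp'' (var 0)))) s' (10 + 6) (J j)"
        using J by (intro dec) (simp_all add: J_def)
    qed
    from runs_While[where I=J, OF \<open>J ?n s'\<close> this] show ?thesis
      unfolding W2_def by (rule runs_mono) (auto simp: J_def algebra_simps)
  qed
  let ?s1 = "s0(''var'' := (s0 ''var'')(0 := ?n))"
  have I1: "I ?n ?s1" using s0 by (simp add: I_def simulates_def)
  have mid: "runs (Seq (Write ''var'' (Const 0) b) W2) s' (cost b + ?n * 20 + 5) (J 0)"
    if I: "I 0 s'" for s'
  proof -
    have "val b s' = ?n" using val I by (simp add: I_def simulates_def)
    moreover have "J ?n (s'(''var'' := (s' ''var'')(0 := ?n)))"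
    proof -
      have "(\<lambda>i. if ?n \<le> i \<and> i < ?n then ?f i else s a i) = s a" by (rule ext) simp
      then have "s(a := \<lambda>i. if ?n \<le> i \<and> i < ?n then ?f i else s a i) = s"
        by (simp only: fun_upd_triv)
      then show ?thesis using I unfolding J_def by (simp add: I_def simulates_def)
    qed
    ultimately show ?thesis
      by (intro runs_Seq_Write[where ?T2.0="?n * 20 + 3"]) (use loop2 in simp_all)
  qed
  have "runs (Seq W1 (Seq (Write ''var'' (Const 0) b) W2)) ?s1
      (?n * (tcost t N + 40) + cost b + 8) (J 0)"
    by (rule runs_Seq[OF loop1[OF I1] mid]) (simp_all add: algebra_simps)
  then have "runs (Seq (Write ''var'' (Const 0) b) (Seq W1 (Seq (Write ''var'' (Const 0) b) W2))) s0
      (?n * (tcost t N + 40) + 2 * cost b + 12) (J 0)"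
    by (intro runs_Seq_Write[where ?T2.0="?n * (tcost t N + 40) + cost b + 8"])
      (use val[OF s0] in simp_all)
  then show "runs (Seq (Write ''var'' (Const 0) b)
     (Seq (While (var 0) (Seq (Write ''var'' (Const 0) (Minus (var 0) (Const 1)))
          (Seq (compile t 1) (Write ''tmp'' (var 0) (cell ''res'')))))
       (Seq (Write ''var'' (Const 0) b) (While (var 0)
          (Seq (Write ''var'' (Const 0) (Minus (var 0) (Const 1)))
               (Write a (var 0) (Read ''tmp'' (var 0)))))))) s0 (upd_cost b t N)
     (simulates d (s(a := \<lambda>i. if i < ?n then ?f i else s a i)) s0)"
    unfolding W1_def[symmetric] W2_def[symmetric]
  proof (rule runs_mono)
    show "?n * (tcost t N + 40) + 2 * cost b + 12 \<le> upd_cost b t N"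
      using mult_right_mono[OF n, of "tcost t N + 40"] by (simp add: upd_cost_def)
    fix s' assume "J 0 s'"
    then have "simulates d (s(a := \<lambda>i. if 0 \<le> i \<and> i < ?n then ?f i else s a i)) s0 s'"
      unfolding J_def by blast
    then show "simulates d (s(a := \<lambda>i. if i < ?n then ?f i else s a i)) s0 s'"
      by (simp only: le0 simp_thms)
  qed
qed

section \<open>Enumeration of tuples by an odometer\<close>

definition digit :: "nat \<Rightarrow> nat \<Rightarrow> nat \<Rightarrow> nat" where
  "digit n c i = c div n ^ i mod n"

text \<open>The \<open>i\<close> lowest digits are all \<open>n - 1\<close> exactly if adding one
  turns them all into zeros.\<close>

lemma carry_iff:
  assumes "0 < n"
  shows "(\<forall>j<i. Suc (digit n c j) = n) \<longleftrightarrow> Suc c mod n ^ i = 0"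
proof (induction i)
  case 0
  then show ?case by simp
next
  case (Suc i)
  have "(\<forall>j<Suc i. Suc (digit n c j) = n) \<longleftrightarrow> Suc c mod n ^ i = 0 \<and> Suc (digit n c i) = n"
    using Suc by (auto simp: less_Suc_eq)
  also have "\<dots> \<longleftrightarrow> Suc c mod n ^ i = 0 \<and> Suc c div n ^ i mod n = 0"
    using assms by (auto simp: digit_def div_Suc mod_Suc)
  also have "\<dots> \<longleftrightarrow> Suc c mod n ^ Suc i = 0"
    by (simp only: mod_mult2_eq power_Suc2) (use assms in auto)
  finally show ?case .
qed

text \<open>The carry rule of an odometer: it lets the program enumerate all tuples without
  division.\<close>

lemma digit_Suc:
  assumes "0 < n"
  shows "digit n (Suc c) i = (if \<forall>j<i. Suc (digit n c j) = n
     then if Suc (digit n c i) = n then 0 else Suc (digit n c i) else digit n c i)"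
  unfolding carry_iff[OF assms] by (simp add: digit_def div_Suc mod_Suc)

lemma digits_surj:
  assumes "\<And>i. i < m \<Longrightarrow> f i < n"
  shows "\<exists>c < n ^ m. \<forall>i<m. digit n c i = f i"
  using assms
proof (induction m arbitrary: f)
  case 0
  then show ?case by auto
next
  case (Suc m)
  from Suc.IH[of "\<lambda>i. f (Suc i)"] Suc.prems obtain c where
    c: "c < n ^ m" "\<And>i. i < m \<Longrightarrow> digit n c i = f (Suc i)" by auto
  have f0: "f 0 < n" using Suc.prems by simp
  \<comment> \<open>A Horner step: \<open>f 0\<close> becomes the lowest digit, and dividing by
    \<open>n\<close> exposes the code of the shifted tuple.\<close>
  let ?c = "c * n + f 0"
  have "Suc c * n \<le> n ^ m * n" using c(1) by (intro mult_right_mono) auto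
  then have "?c < n ^ Suc m" using f0 by (simp add: mult.commute)
  moreover have "digit n ?c i = f i" if i: "i < Suc m" for i
  proof (cases i)
    case 0
    then show ?thesis using f0 by (simp add: digit_def)
  next
    case (Suc j)
    have "?c div n ^ Suc j = c div n ^ j" using f0 by (simp add: div_mult2_eq)
    then have "digit n ?c i = digit n c j" unfolding digit_def Suc by simp
    then show ?thesis using c(2)[of j] i Suc by simp
  qed
  ultimately show ?case by blast
qed

lemma digit_set_surj:
  assumes "F \<subseteq> {..<n}" "F \<noteq> {}" "card F \<le> m"
  shows "\<exists>c < n ^ m. digit n c ` {..<m} = F"
proof -
  have fin: "finite F" using assms(1) finite_subset by blast
  then obtain b where b: "bij_betw b {..<card F} F"
    using ex_bij_betw_nat_finite atLeast0LessThan by metis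
  \<comment> \<open>Tuples have fixed length \<open>m\<close>; a smaller set is padded by repeating
    \<open>b 0\<close>, which exists because \<open>F\<close> is nonempty.\<close>
  define f where "f i = (if i < card F then b i else b 0)" for i
  have pos: "0 < card F" using fin assms(2) by (simp add: card_gt_0_iff)
  have bF: "b i \<in> F" if "i < card F" for i using b that by (auto simp: bij_betw_def)
  have "f ` {..<m} = F"
  proof
    show "f ` {..<m} \<subseteq> F" using bF pos by (auto simp: f_def)
    show "F \<subseteq> f ` {..<m}"
    proof
      fix x assume "x \<in> F"
      then obtain i where "i < card F" "x = b i" using b by (auto simp: bij_betw_def)
      then show "x \<in> f ` {..<m}" using assms(3) by (intro image_eqI[of _ _ i]) (auto simp: f_def)
    qed
  qed
  moreover from this have "f i < n" if "i < m" for i using that assms(1) by blast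
  ultimately show ?thesis using digits_surj[of m f n] by (metis image_cong lessThan_iff)
qed

section \<open>The program\<close>

abbreviation vcount :: expr where "vcount \<equiv> cell ''n''"

text \<open>The table \<open>row\<close> holds the offsets \<open>u * n\<close>, which cannot be
  formed by a multiplication on the spot.\<close>

definition Edge :: "expr \<Rightarrow> expr \<Rightarrow> tm" where
  "Edge u v = Ret (Read ''adj'' (Plus (Read ''row'' u) v))"

definition Or :: "tm \<Rightarrow> tm \<Rightarrow> tm" where
  "Or a b = IfT a (Ret (Const 1)) (IfT b (Ret (Const 1)) (Ret (Const 0)))"

definition And :: "tm \<Rightarrow> tm \<Rightarrow> tm" where
  "And a b = IfT a (IfT b (Ret (Const 1)) (Ret (Const 0))) (Ret (Const 0))"

definition Neg :: "tm \<Rightarrow> tm" where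
  "Neg a = IfT a (Ret (Const 0)) (Ret (Const 1))"

definition Iff :: "tm \<Rightarrow> tm \<Rightarrow> tm" where
  "Iff a b = IfT a (IfT b (Ret (Const 1)) (Ret (Const 0))) (Neg b)"

text \<open>Truth means nonzero, so the truncated difference itself serves as the answer.\<close>

definition Less :: "expr \<Rightarrow> expr \<Rightarrow> tm" where
  "Less a b = Ret (Minus b a)"

definition Equal :: "expr \<Rightarrow> expr \<Rightarrow> tm" where
  "Equal a b = Neg (Or (Less a b) (Less b a))"

definition Count :: "expr \<Rightarrow> tm \<Rightarrow> tm" where
  "Count b t = SumT b (IfT t (Ret (Const 1)) (Ret (Const 0)))"

definition Forall :: "expr \<Rightarrow> tm \<Rightarrow> tm \<Rightarrow> tm" where
  "Forall b p t = Neg (Count b (And p (Neg t)))"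

lemmas tm_defs = Edge_def Or_def And_def Neg_def Iff_def Less_def Equal_def Count_def Forall_def

lemma eval_Edge [simp]: "eval (Edge u v) d \<rho> s =
    s ''adj'' (s ''row'' (val u (s(''var'' := \<rho>))) + val v (s(''var'' := \<rho>)))"
  by (simp add: Edge_def)

lemma eval_Or [simp]: "eval (Or a b) d \<rho> s = of_bool (eval a d \<rho> s \<noteq> 0 \<or> eval b d \<rho> s \<noteq> 0)"
  by (simp add: Or_def)

lemma eval_And [simp]: "eval (And a b) d \<rho> s = of_bool (eval a d \<rho> s \<noteq> 0 \<and> eval b d \<rho> s \<noteq> 0)"
  by (simp add: And_def)

lemma eval_Neg [simp]: "eval (Neg a) d \<rho> s = of_bool (eval a d \<rho> s = 0)"
  by (simp add: Neg_def)

lemma eval_Iff [simp]: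
  "eval (Iff a b) d \<rho> s = of_bool (eval a d \<rho> s \<noteq> 0 \<longleftrightarrow> eval b d \<rho> s \<noteq> 0)"
  by (simp add: Iff_def)

lemma eval_Less [simp]: "eval (Less a b) d \<rho> s = val b (s(''var'' := \<rho>)) - val a (s(''var'' := \<rho>))"
  by (simp add: Less_def)

lemma eval_Equal [simp]:
  "eval (Equal a b) d \<rho> s = of_bool (val a (s(''var'' := \<rho>)) = val b (s(''var'' := \<rho>)))"
  by (auto simp: Equal_def)

lemma eval_GeT [simp]:
  "eval (GeT t e) d \<rho> s = of_bool (val e (s(''var'' := \<rho>)) \<le> eval t d \<rho> s)"
  by simp

declare eval.simps(4) [simp del]

lemma eval_Count [simp]:
  "eval (Count b t) d \<rho> s = card {i. i < val b s \<and> eval t (Suc d) (\<rho>(d := i)) s \<noteq> 0}"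
proof -
  have "eval (Count b t) d \<rho> s = (\<Sum>i<val b s. of_bool (eval t (Suc d) (\<rho>(d := i)) s \<noteq> 0))"
    unfolding Count_def eval.simps of_bool_def by (intro sum.cong) simp_all
  also have "\<dots> = card ({..<val b s} \<inter> {i. eval t (Suc d) (\<rho>(d := i)) s \<noteq> 0})"
    by (subst sum_of_bool_eq) simp_all
  also have "{..<val b s} \<inter> {i. eval t (Suc d) (\<rho>(d := i)) s \<noteq> 0} =
      {i. i < val b s \<and> eval t (Suc d) (\<rho>(d := i)) s \<noteq> 0}" by auto
  finally show ?thesis .
qed

text \<open>\<open>Count\<close> doubles as the existential quantifier. With
  \<open>eval_Count\<close> later removed from the simplifier, cardinalities appear only where they
  are asked for.\<close>

lemma eval_Count_pos [simp]:
  "0 < eval (Count b t) d \<rho> s \<longleftrightarrow> (\<exists>i<val b s. eval t (Suc d) (\<rho>(d := i)) s \<noteq> 0)"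
proof -
  have "finite {i. i < val b s \<and> eval t (Suc d) (\<rho>(d := i)) s \<noteq> 0}" by simp
  then show ?thesis by (auto simp: card_gt_0_iff simp del: finite_Collect_conjI)
qed

lemma eval_Forall [simp]:
  "eval (Forall b p t) d \<rho> s = of_bool (\<forall>i<val b s.
     eval p (Suc d) (\<rho>(d := i)) s \<noteq> 0 \<longrightarrow> eval t (Suc d) (\<rho>(d := i)) s \<noteq> 0)"
proof -
  have "eval (Forall b p t) d \<rho> s = of_bool (\<not> 0 < eval (Count b (And p (Neg t))) d \<rho> s)"
    by (simp only: Forall_def eval_Neg not_gr_zero)
  then show ?thesis unfolding eval_Count_pos by auto
qed

declare eval_Count [simp del]

lemma sum_card_pairs:
  "(\<Sum>x<n. card {y. y < n \<and> P x y}) = card {(x, y). x < n \<and> y < n \<and> P x y}" for n :: nat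
proof -
  have "{(x, y). x < n \<and> y < n \<and> P x y} = (SIGMA x:{..<n}. {y. y < n \<and> P x y})" by auto
  then show ?thesis by simp
qed

section \<open>The search program\<close>

definition Near :: "nat \<Rightarrow> nat \<Rightarrow> tm" where
  "Near i d = Forall vcount (Ret (Read ''U'' (var d)))
     (Or (Equal (var d) (var i)) (Or (Edge (var d) (var i))
       (Count vcount (And (Ret (Read ''U'' (var (d + 1))))
         (And (Edge (var d) (var (d + 1))) (Edge (var (d + 1)) (var i)))))))"

definition Links :: "nat \<Rightarrow> nat \<Rightarrow> tm" where
  "Links i d = SumT vcount (Count vcount (And (Ret (Read ''U'' (var d)))
     (And (Ret (Read ''U'' (var (d + 1)))) (And (Less (var d) (var (d + 1)))
     (And (Edge (var i) (var d)) (And (Edge (var i) (var (d + 1))) (Edge (var d) (var (d + 1)))))))))"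

text \<open>\<open>i\<close> is the level holding the tested vertex and \<open>d\<close> the first
  free level. Pruning uses levels 0 and 1, the final test levels 1 and 2.\<close>

definition Good :: "nat \<Rightarrow> nat \<Rightarrow> nat \<Rightarrow> tm" where
  "Good r i d = And (Near i d) (GeT (Links i d) (Const r))"

text \<open>Level 0 holds the \<open>v\<close> of \<open>candidates\<close>, level 1 its
  \<open>f\<close> or \<open>g\<close>, and level 2 its \<open>x\<close>.\<close>

definition Candidate :: tm where
  "Candidate = Or (Ret (Read ''F'' (var 0))) (And (Neg (Ret (Read ''X'' (var 0)))) (And
     (Count vcount (And (And (Ret (Read ''F'' (var 1))) (Neg (Ret (Read ''X'' (var 1)))))
        (Forall vcount (And (Ret (Read ''F'' (var 2))) (Ret (Read ''X'' (var 2))))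
          (Iff (Edge (var 0) (var 2)) (Edge (var 1) (var 2))))))
     (Forall vcount (And (Ret (Read ''F'' (var 1))) (Neg (Ret (Read ''X'' (var 1)))))
        (Count vcount (And (And (Ret (Read ''F'' (var 2))) (Ret (Read ''X'' (var 2))))
          (And (Edge (var 0) (var 2)) (Edge (var 1) (var 2))))))))"

text \<open>\<open>row\<close> adds \<open>n\<close> once for each index below \<open>u\<close>.
  \<open>k\<close> counts the \<open>j < n\<close> for which at least \<open>j + 1\<close> vertices
  have degree at least \<open>j + 1\<close>; as these thresholds form an initial segment, their
  number is the h-index.\<close>

definition setup_graph :: prog where
  "setup_graph =
    Then (Upd ''row'' vcount (SumT vcount (IfT (Less (var 1) (var 0)) (Ret vcount) (Ret (Const 0)))))
   (Then (Upd ''k'' (Const 1)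
     (Count vcount (GeT (Count vcount (GeT (Count vcount (Edge (var 2) (var 3))) (Plus (var 1) (Const 1))))
        (Plus (var 1) (Const 1)))))
     (Upd ''X'' vcount (GeT (Count vcount (Edge (var 0) (var 1))) (Plus (cell ''k'') (Const 1)))))"

text \<open>Starting from 2, each round performs three doublings, giving
  \<open>2 * 8 ^ k\<close>.\<close>

definition setup_width :: prog where
  "setup_width =
    Then (Upd ''m'' (Const 1) (Ret (Const 2)))
     (Rep (cell ''k'') (Upd ''m'' (Const 1) (Ret
       (let m = cell ''m''; m2 = Plus m m; m4 = Plus m2 m2 in Plus m4 m4))))"

text \<open>\<open>q\<close> becomes \<open>n ^ m\<close>, each factor \<open>n\<close> being a sum
  of \<open>n\<close> copies. \<open>out\<close> starts with the verdict on the empty solution,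
  which no tuple represents.\<close>

definition setup_search :: prog where
  "setup_search =
    Then (Upd ''q'' (Const 1) (Ret (Const 1)))
   (Then (Rep (cell ''m'') (Upd ''q'' (Const 1) (SumT vcount (Ret (cell ''q'')))))
     (Upd ''out'' (Const 1) (Neg (Ret (cell ''l'')))))"

text \<open>\<open>F\<close> stores multiplicities in the tuple; only their being nonzero
  matters.\<close>

definition find_club :: "nat \<Rightarrow> prog" where
  "find_club r =
    Then (Upd ''F'' vcount (Count (cell ''m'') (Equal (Read ''a'' (var 1)) (var 0))))
   (Then (Upd ''U'' vcount Candidate)
     (Rep vcount (Upd ''U'' vcount (And (Ret (Read ''U'' (var 0)))
       (Or (Ret (Read ''F'' (var 0))) (Good r 0 1))))))"

text \<open>The last update advances the odometer. It relies on updates being simultaneous: every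
  position decides on its carry from the old digits.\<close>

definition search_step :: "nat \<Rightarrow> prog" where
  "search_step r =
    Then (find_club r)
   (Then (Upd ''out'' (Const 1) (Or (Ret (cell ''out''))
       (And (Forall vcount (Ret (Read ''U'' (var 1))) (Good r 1 2))
         (GeT (Count vcount (Ret (Read ''U'' (var 1)))) (cell ''l'')))))
     (Upd ''a'' (cell ''m'') (IfT
       (Forall (cell ''m'') (Less (var 1) (var 0)) (Neg (Less (Plus (Read ''a'' (var 1)) (Const 1)) vcount)))
       (IfT (Less (Plus (Read ''a'' (var 0)) (Const 1)) vcount)
         (Ret (Plus (Read ''a'' (var 0)) (Const 1))) (Ret (Const 0)))
       (Ret (Read ''a'' (var 0))))))"

definition main_prog :: "nat \<Rightarrow> prog" where
  "main_prog r =
    Then setup_graph (Then setup_width (Then setup_search (Rep (cell ''q'') (search_step r))))"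

section \<open>Correctness of the search program\<close>

definition members :: "nat \<Rightarrow> string \<Rightarrow> state \<Rightarrow> nat set" where
  "members n a s = {v. v < n \<and> s a v \<noteq> 0}"

definition stores_graph :: "nat \<Rightarrow> (nat \<Rightarrow> nat \<Rightarrow> bool) \<Rightarrow> state \<Rightarrow> bool" where
  "stores_graph n E s \<longleftrightarrow> s ''n'' 0 = n \<and>
    (\<forall>u<n. \<forall>v<n. s ''adj'' (s ''row'' u + v) \<noteq> 0 \<longleftrightarrow> E u v)"

lemma eval_Good:
  assumes "stores_graph n E s" "i < d" "\<rho> i < n"
  shows "eval (Good r i d) d \<rho> s = of_bool (good E r (members n ''U'' s) (\<rho> i))"
proof -
  have n: "s ''n'' 0 = n" and E: "\<And>u v. u < n \<Longrightarrow> v < n \<Longrightarrow> 0 < s ''adj'' (s ''row'' u + v) \<longleftrightarrow> E u v"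
    using assms(1) by (auto simp: stores_graph_def)
  let ?v = "\<rho> i" and ?U = "members n ''U'' s"
  have i: "i \<noteq> d" "i \<noteq> Suc d" using assms(2) by auto
  have "eval (Near i d) d \<rho> s \<noteq> 0 \<longleftrightarrow> (\<forall>u\<in>?U. near E ?U u ?v)"
    using i assms(3)
    by (simp add: Near_def n near_def members_def E imp_conjL cong: conj_cong imp_cong) auto
  moreover have "eval (Links i d) d \<rho> s = card (links E ?U ?v)"
  proof -
    have "eval (Links i d) d \<rho> s = card {(x, y). x < n \<and> y < n \<and>
        0 < s ''U'' x \<and> 0 < s ''U'' y \<and> \<not> y \<le> x \<and> 0 < s ''adj'' (s ''row'' ?v + x) \<and>
        0 < s ''adj'' (s ''row'' ?v + y) \<and> 0 < s ''adj'' (s ''row'' x + y)}"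
      using i by (simp add: Links_def n eval_Count sum_card_pairs)
    also have "\<dots> = card (links E ?U ?v)"
      using assms(3) by (intro arg_cong[where f=card]) (auto simp: links_def members_def E)
    finally show ?thesis .
  qed
  ultimately show ?thesis by (simp add: Good_def good_def)
qed

lemma eval_Candidate:
  assumes "stores_graph n E s" "v < n"
  shows "eval Candidate 1 (\<lambda>_. v) s \<noteq> 0 \<longleftrightarrow>
    v \<in> candidates E {..<n} (members n ''X'' s) (members n ''F'' s)"
proof -
  have n: "s ''n'' 0 = n" and E: "\<And>u v. u < n \<Longrightarrow> v < n \<Longrightarrow> 0 < s ''adj'' (s ''row'' u + v) \<longleftrightarrow> E u v"
    using assms(1) by (auto simp: stores_graph_def)
  have "eval Candidate 1 (\<lambda>_. v) s \<noteq> 0 \<longleftrightarrow> 0 < s ''F'' v \<or> s ''X'' v = 0 \<and>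
      (\<exists>f<n. 0 < s ''F'' f \<and> s ''X'' f = 0 \<and>
        (\<forall>x<n. s ''F'' x = 0 \<or> s ''X'' x = 0 \<or> E v x = E f x)) \<and>
      (\<forall>g<n. s ''F'' g = 0 \<or> 0 < s ''X'' g \<or>
        (\<exists>x<n. 0 < s ''F'' x \<and> 0 < s ''X'' x \<and> E v x \<and> E g x))"
    using assms(2) by (simp add: Candidate_def n E cong: conj_cong imp_cong) blast
  also have "\<dots> \<longleftrightarrow> v \<in> candidates E {..<n} (members n ''X'' s) (members n ''F'' s)"
  proof -
    let ?F = "members n ''F'' s" and ?X = "members n ''X'' s"
    have "(\<exists>f<n. 0 < s ''F'' f \<and> s ''X'' f = 0 \<and> (\<forall>x<n. s ''F'' x = 0 \<or> s ''X'' x = 0 \<or> E v x = E f x))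
        \<longleftrightarrow> (\<exists>f\<in>?F - ?X. \<forall>x\<in>?F \<inter> ?X. E v x = E f x)"
      unfolding Bex_def by (intro ex_cong1) (auto simp: members_def)
    moreover have "(\<forall>g<n. s ''F'' g = 0 \<or> 0 < s ''X'' g \<or>
          (\<exists>x<n. 0 < s ''F'' x \<and> 0 < s ''X'' x \<and> E v x \<and> E g x))
        \<longleftrightarrow> (\<forall>g\<in>?F - ?X. \<exists>x\<in>?F \<inter> ?X. E v x \<and> E g x)"
      unfolding Ball_def by (intro all_cong1) (auto simp: members_def)
    moreover have "v \<in> ?F \<longleftrightarrow> 0 < s ''F'' v" "v \<notin> ?X \<longleftrightarrow> s ''X'' v = 0"
      using assms(2) by (auto simp: members_def)
    ultimately show ?thesis using assms(2) unfolding candidates_def by simp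
  qed
  finally show ?thesis .
qed

lemma stores_graph_cong:
  "stores_graph n E s \<Longrightarrow> s' ''n'' = s ''n'' \<Longrightarrow> s' ''adj'' = s ''adj'' \<Longrightarrow> s' ''row'' = s ''row'' \<Longrightarrow>
    stores_graph n E s'"
  by (simp add: stores_graph_def)

lemma members_cong: "s' a = s a \<Longrightarrow> members n a s' = members n a s"
  by (simp add: members_def)

lemma members_upd:
  "members n a (s(a := \<lambda>i. if i < n then f i else g i)) = {v. v < n \<and> f v \<noteq> 0}"
  by (auto simp: members_def)

lemma sem_prune:
  fixes r :: nat
  assumes "stores_graph n E s"
  defines "s' \<equiv> sem (Upd ''U'' vcount (And (Ret (Read ''U'' (var 0)))
       (Or (Ret (Read ''F'' (var 0))) (Good r 0 1)))) s"
  shows "members n ''U'' s' = prune E r (members n ''F'' s) (members n ''U'' s)"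
    and "\<And>y. y \<noteq> ''U'' \<Longrightarrow> s' y = s y"
proof -
  have n: "val vcount s = n" using assms(1) by (simp add: stores_graph_def)
  have "eval (And (Ret (Read ''U'' (var 0))) (Or (Ret (Read ''F'' (var 0))) (Good r 0 1))) 1 (\<lambda>_. v) s \<noteq> 0
      \<longleftrightarrow> s ''U'' v \<noteq> 0 \<and> (s ''F'' v \<noteq> 0 \<or> good E r (members n ''U'' s) v)" if "v < n" for v
    using eval_Good[OF assms(1), of 0 1 "\<lambda>_. v" r] that by simp
  then have "members n ''U'' s' = {v. v < n \<and> (s ''U'' v \<noteq> 0 \<and> (s ''F'' v \<noteq> 0 \<or> good E r (members n ''U'' s) v))}"
    unfolding s'_def sem.simps n members_upd by (intro Collect_cong conj_cong refl)
  then show "members n ''U'' s' = prune E r (members n ''F'' s) (members n ''U'' s)"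
    by (auto simp: prune_def members_def)
  show "s' y = s y" if "y \<noteq> ''U''" for y using that by (simp add: s'_def)
qed

lemma sem_find_club:
  assumes G: "stores_graph n E s" and X: "members n ''X'' s = X"
    and F: "s ''a'' ` {..<s ''m'' 0} = F" "F \<subseteq> {..<n}"
  shows "members n ''U'' (sem (find_club r) s) = (prune E r F ^^ n) (candidates E {..<n} X F)"
    and "\<And>y. y \<noteq> ''F'' \<Longrightarrow> y \<noteq> ''U'' \<Longrightarrow> sem (find_club r) s y = s y"
proof -
  define s1 where "s1 = sem (Upd ''F'' vcount (Count (cell ''m'') (Equal (Read ''a'' (var 1)) (var 0)))) s"
  define s2 where "s2 = sem (Upd ''U'' vcount Candidate) s1"
  define P where "P = Upd ''U'' vcount (And (Ret (Read ''U'' (var 0))) (Or (Ret (Read ''F'' (var 0))) (Good r 0 1)))"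
  have n: "val vcount s = n" using G by (simp add: stores_graph_def)
  have s1: "s1 y = s y" if "y \<noteq> ''F''" for y using that by (simp add: s1_def)
  have G1: "stores_graph n E s1" by (rule stores_graph_cong[OF G]) (simp_all add: s1)
  have F1: "members n ''F'' s1 = F"
    unfolding s1_def sem.simps n members_upd using F(2) by (auto simp flip: F(1))
  have X1: "members n ''X'' s1 = X" using X by (simp add: members_def s1)
  have n1: "val vcount s1 = n" using G1 by (simp add: stores_graph_def)
  have s2: "s2 y = s1 y" if "y \<noteq> ''U''" for y using that by (simp add: s2_def)
  have "members n ''U'' s2 = {v. v < n \<and> v \<in> candidates E {..<n} X F}"
    unfolding s2_def sem.simps n1 members_upd
    by (intro Collect_cong conj_cong refl) (rule eval_Candidate[OF G1, unfolded F1 X1])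
  then have U2: "members n ''U'' s2 = candidates E {..<n} X F"
    using candidates_subset[OF F(2), of E X] by auto
  have G2: "stores_graph n E s2" by (rule stores_graph_cong[OF G1]) (simp_all add: s2)
  have F2: "members n ''F'' s2 = F" using F1 by (simp add: members_def s2)
  have loop: "members n ''U'' ((sem P ^^ i) s2) = (prune E r F ^^ i) (candidates E {..<n} X F) \<and>
      (\<forall>y. y \<noteq> ''U'' \<longrightarrow> (sem P ^^ i) s2 y = s2 y)" for i
  proof (induction i)
    case 0
    then show ?case using U2 by simp
  next
    case (Suc i)
    have "stores_graph n E ((sem P ^^ i) s2)"
      by (rule stores_graph_cong[OF G2]) (use Suc in simp_all)
    moreover have "members n ''F'' ((sem P ^^ i) s2) = F" using F2 Suc by (simp add: members_def)
    ultimately show ?case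
      using sem_prune[where n=n and E=E and s="(sem P ^^ i) s2" and r=r, folded P_def] Suc by simp
  qed
  have "val vcount s2 = n" using G2 by (simp add: stores_graph_def)
  then have sem: "sem (find_club r) s = (sem P ^^ n) s2"
    by (simp only: find_club_def sem.simps s1_def[unfolded sem.simps, symmetric] P_def[symmetric]
        s2_def[unfolded sem.simps, symmetric])
  show "members n ''U'' (sem (find_club r) s) = (prune E r F ^^ n) (candidates E {..<n} X F)"
    using loop unfolding sem by simp
  show "sem (find_club r) s y = s y" if "y \<noteq> ''F''" "y \<noteq> ''U''" for y
    using loop s1 s2 that unfolding sem by simp
qed

text \<open>\<open>c\<close> is a ghost number: the memory described here holds only its
  digits.\<close>

definition search_inv ::
  "nat \<Rightarrow> (nat \<Rightarrow> nat \<Rightarrow> bool) \<Rightarrow> nat set \<Rightarrow> nat \<Rightarrow> nat \<Rightarrow> nat \<Rightarrow> nat \<Rightarrow> state \<Rightarrow> bool" where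
  "search_inv n E X m l r c s \<longleftrightarrow> stores_graph n E s \<and> members n ''X'' s = X \<and> s ''m'' 0 = m \<and>
    s ''l'' 0 = l \<and> (\<forall>i<m. s ''a'' i = digit n c i) \<and>
    s ''out'' 0 = of_bool (l = 0 \<or> (\<exists>b<c. accepts E r {..<n} X l (digit n b ` {..<m})))"

lemma digit_less: "0 < n \<Longrightarrow> digit n c i < n"
  by (simp add: digit_def)

lemma sem_search_step:
  assumes inv: "search_inv n E X m l r c s" and "0 < n"
  shows "search_inv n E X m l r (Suc c) (sem (search_step r) s)"
proof -
  let ?F = "digit n c ` {..<m}"
  define s1 where "s1 = sem (find_club r) s"
  define s2 where "s2 = sem (Upd ''out'' (Const 1) (Or (Ret (cell ''out''))
       (And (Forall vcount (Ret (Read ''U'' (var 1))) (Good r 1 2))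
         (GeT (Count vcount (Ret (Read ''U'' (var 1)))) (cell ''l''))))) s1"
  define s3 where "s3 = sem (search_step r) s"
  have G: "stores_graph n E s" and X: "members n ''X'' s = X" and m: "s ''m'' 0 = m" and l: "s ''l'' 0 = l"
    and a: "\<And>i. i < m \<Longrightarrow> s ''a'' i = digit n c i"
    and out: "s ''out'' 0 = of_bool (l = 0 \<or> (\<exists>b<c. accepts E r {..<n} X l (digit n b ` {..<m})))"
    using inv by (auto simp: search_inv_def)
  have F: "s ''a'' ` {..<s ''m'' 0} = ?F" "?F \<subseteq> {..<n}"
    using a m digit_less[OF assms(2)] by (auto intro!: image_cong)
  have s1: "s1 y = s y" if "y \<noteq> ''F''" "y \<noteq> ''U''" for y
    unfolding s1_def using sem_find_club(2)[OF G X F] that by blast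
  have G1: "stores_graph n E s1" by (rule stores_graph_cong[OF G]) (simp_all add: s1)
  have n1: "s1 ''n'' 0 = n" using G1 by (simp add: stores_graph_def)
  define U where "U = members n ''U'' s1"
  have acc: "accepts E r {..<n} X l ?F \<longleftrightarrow> (\<forall>v\<in>U. good E r U v) \<and> l \<le> card U"
    unfolding U_def s1_def sem_find_club(1)[OF G X F] accepts_def by simp
  have s2: "s2 y = s1 y" if "y \<noteq> ''out''" for y using that by (simp add: s2_def)
  have good1: "eval (Good r 1 2) 2 ((\<lambda>_. 0)(Suc 0 := v)) s1 = of_bool (good E r U v)" if "v < n" for v
    using eval_Good[OF G1, of 1 2 "(\<lambda>_. 0)(Suc 0 := v)" r] that by (simp add: U_def)
  have "s2 ''out'' 0 = of_bool (s1 ''out'' 0 \<noteq> 0 \<or> (\<forall>v\<in>U. good E r U v) \<and> l \<le> card U)"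
    using good1 n1 l by (auto simp: s2_def s1 eval_Count U_def members_def numeral_2_eq_2)
  then have out2: "s2 ''out'' 0 = of_bool (l = 0 \<or> (\<exists>b<Suc c. accepts E r {..<n} X l (digit n b ` {..<m})))"
    using out by (auto simp: acc[symmetric] s1 less_Suc_eq)
  have s3: "s3 = sem (Upd ''a'' (cell ''m'') (IfT
       (Forall (cell ''m'') (Less (var 1) (var 0)) (Neg (Less (Plus (Read ''a'' (var 1)) (Const 1)) vcount)))
       (IfT (Less (Plus (Read ''a'' (var 0)) (Const 1)) vcount)
         (Ret (Plus (Read ''a'' (var 0)) (Const 1))) (Ret (Const 0)))
       (Ret (Read ''a'' (var 0))))) s2"
    unfolding s3_def search_step_def by (simp only: sem.simps s1_def s2_def)
  have s3_other: "s3 y = s2 y" if "y \<noteq> ''a''" for y using that by (simp add: s3)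
  have a2: "s2 ''a'' i = digit n c i" if "i < m" for i using a that by (simp add: s1 s2)
  have nm2: "s2 ''n'' 0 = n" "s2 ''m'' 0 = m" using n1 m by (simp_all add: s1 s2)
  have a3: "s3 ''a'' i = digit n (Suc c) i" if i: "i < m" for i
  proof -
    have "s3 ''a'' i = (if \<forall>j<m. i \<le> j \<or> n \<le> Suc (digit n c j)
        then if Suc (digit n c i) < n then Suc (digit n c i) else 0 else digit n c i)"
      using i by (simp add: s3 nm2 a2 cong: imp_cong) blast
    also have "\<dots> = digit n (Suc c) i"
    proof -
      have "n \<le> Suc (digit n c j) \<longleftrightarrow> Suc (digit n c j) = n"
        and "Suc (digit n c j) < n \<longleftrightarrow> Suc (digit n c j) \<noteq> n" for j
        using digit_less[OF assms(2), of c j] by auto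
      moreover have "(\<forall>j<m. i \<le> j \<or> Suc (digit n c j) = n) \<longleftrightarrow> (\<forall>j<i. Suc (digit n c j) = n)"
        using i by (meson not_le order_less_trans)
      ultimately show ?thesis by (simp add: digit_Suc[OF assms(2)]) blast
    qed
    finally show ?thesis .
  qed
  have "stores_graph n E s3" by (rule stores_graph_cong[OF G]) (simp_all add: s1 s2 s3_other)
  moreover have "members n ''X'' s3 = X" using X by (simp add: members_def s1 s2 s3_other)
  ultimately show ?thesis
    unfolding search_inv_def s3_def[symmetric]
    using a3 out2 m l by (simp add: s1 s2 s3_other)
qed

lemma sem_setup_graph:
  fixes l :: nat
  assumes pg: "pair_graph G" and V: "pverts G = {..<n}"
  defines "s \<equiv> sem setup_graph (input_state G l)"
  shows "stores_graph n (\<lambda>u v. (u, v) \<in> parcs G) s" and "s ''k'' 0 = h_index G"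
    and "members n ''X'' s = {v. v < n \<and> h_index G < out_degree (with_proj G) v}"
    and "s ''l'' 0 = l" and "s ''a'' = (\<lambda>_. 0)"
proof -
  interpret pair_graph G by fact
  let ?E = "\<lambda>u v. (u, v) \<in> parcs G"
  let ?d = "out_degree (with_proj G)"
  define s0 where "s0 = input_state G l"
  define s1 where "s1 = sem (Upd ''row'' vcount (SumT vcount (IfT (Less (var 1) (var 0)) (Ret vcount) (Ret (Const 0))))) s0"
  define s2 where "s2 = sem (Upd ''k'' (Const 1)
     (Count vcount (GeT (Count vcount (GeT (Count vcount (Edge (var 2) (var 3))) (Plus (var 1) (Const 1))))
        (Plus (var 1) (Const 1))))) s1"
  have s: "s = sem (Upd ''X'' vcount (GeT (Count vcount (Edge (var 0) (var 1))) (Plus (cell ''k'') (Const 1)))) s2"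
    by (simp only: s_def setup_graph_def sem.simps s0_def s1_def s2_def)
  have s0: "s0 ''n'' 0 = n" "s0 ''l'' 0 = l" "s0 ''a'' = (\<lambda>_. 0)"
    "s0 ''adj'' = (\<lambda>i. if i < n * n \<and> (i div n, i mod n) \<in> parcs G then 1 else 0)"
    using V by (simp_all add: s0_def input_state_def Let_def)
  have s1: "s1 y = s0 y" if "y \<noteq> ''row''" for y using that by (simp add: s1_def)
  have row: "s1 ''row'' u = u * n" if "u < n" for u
  proof -
    have "s1 ''row'' u = (\<Sum>i<n. if i < u then n else 0)"
      using that s0 by (simp add: s1_def not_le cong: if_cong)
    also have "\<dots> = (\<Sum>i\<in>{..<n} \<inter> {i. i < u}. n)" by (simp add: sum.If_cases)
    also have "{..<n} \<inter> {i. i < u} = {..<u}" using that by auto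
    finally show ?thesis by simp
  qed
  have adj: "s1 ''adj'' (s1 ''row'' u + v) \<noteq> 0 \<longleftrightarrow> ?E u v" if "u < n" "v < n" for u v
  proof -
    have "Suc u * n \<le> n * n" using that by (intro mult_right_mono) auto
    then have "u * n + v < n * n" using that by simp
    then show ?thesis using that by (simp add: row s1 s0)
  qed
  have G1: "stores_graph n ?E s1" using adj s0 by (simp add: stores_graph_def s1)
  have deg: "card {w. w < n \<and> 0 < s1 ''adj'' (s1 ''row'' v + w)} = ?d v" if "v < n" for v
  proof -
    have "{w. w < n \<and> 0 < s1 ''adj'' (s1 ''row'' v + w)} = {w. ?E v w}"
      using adj[OF that] in_arcsD2 V by auto
    then show ?thesis by (simp add: out_degree_with_proj)
  qed
  have s2: "s2 y = s1 y" if "y \<noteq> ''k''" for y using that by (simp add: s2_def)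
  \<comment> \<open>\<open>k\<close> counts only thresholds up to \<open>n\<close>, so it must be
    ruled out that the h-index lies beyond.\<close>
  have hn: "h_index G \<le> n"
  proof -
    have "h_index G \<le> card {v \<in> pverts G. h_index G \<le> ?d v}"
      using h_index_bound[OF pg] by blast
    also have "\<dots> \<le> card (pverts G)" by (intro card_mono pair_finite_verts) auto
    finally show ?thesis using V by simp
  qed
  have n1: "s1 ''n'' 0 = n" using s0 by (simp add: s1)
  have deg_set: "{v. v < n \<and> Suc j \<le> card {w. w < n \<and> 0 < s1 ''adj'' (s1 ''row'' v + w)}} =
      {v. v < n \<and> Suc j \<le> ?d v}" for j
    using deg by (intro Collect_cong conj_cong) simp_all
  have "s2 ''k'' 0 = card {j. j < n \<and> Suc j \<le> card {v. v < n \<and> Suc j \<le> ?d v}}"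
    by (simp add: s2_def n1 eval_Count deg_set)
  also have "\<dots> = card {j. j < n \<and> Suc j \<le> h_index G}"
    using h_index_bound[OF pg] V by simp
  also have "{j. j < n \<and> Suc j \<le> h_index G} = {..<h_index G}" using hn by auto
  finally have k: "s2 ''k'' 0 = h_index G" by simp
  have s': "s y = s2 y" if "y \<noteq> ''X''" for y using that by (simp add: s)
  show "stores_graph n ?E s" by (rule stores_graph_cong[OF G1]) (simp_all add: s' s2)
  show "s ''k'' 0 = h_index G" by (simp add: s' k)
  show "s ''l'' 0 = l" "s ''a'' = (\<lambda>_. 0)" by (simp_all add: s' s2 s1 s0)
  have n2: "val vcount s2 = n" using s0 by (simp add: s2 s1)
  show "members n ''X'' s = {v. v < n \<and> h_index G < ?d v}"
    unfolding s sem.simps n2 members_upd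
    by (intro Collect_cong conj_cong refl) (simp add: k s2 n1 eval_Count deg Suc_le_eq)
qed

lemma sem_setup_width:
  shows "sem setup_width s ''m'' 0 = 2 * 8 ^ s ''k'' 0"
    and "\<And>y. y \<noteq> ''m'' \<Longrightarrow> sem setup_width s y = s y"
proof -
  let ?P = "Upd ''m'' (Const 1) (Ret (let m = cell ''m''; m2 = Plus m m; m4 = Plus m2 m2 in Plus m4 m4))"
  define s1 where "s1 = sem (Upd ''m'' (Const 1) (Ret (Const 2))) s"
  have s1: "s1 ''m'' 0 = 2" "\<And>y. y \<noteq> ''m'' \<Longrightarrow> s1 y = s y" by (simp_all add: s1_def)
  have loop: "(sem ?P ^^ i) s1 ''m'' 0 = 2 * 8 ^ i \<and> (\<forall>y. y \<noteq> ''m'' \<longrightarrow> (sem ?P ^^ i) s1 y = s1 y)" for i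
    by (induction i) (simp_all add: s1 Let_def)
  have "sem setup_width s = (sem ?P ^^ s1 ''k'' 0) s1"
    by (simp only: setup_width_def sem.simps val.simps s1_def)
  then show "sem setup_width s ''m'' 0 = 2 * 8 ^ s ''k'' 0"
    and "\<And>y. y \<noteq> ''m'' \<Longrightarrow> sem setup_width s y = s y"
    using loop s1(2) by simp_all
qed

lemma sem_setup_search:
  shows "sem setup_search s ''q'' 0 = s ''n'' 0 ^ s ''m'' 0"
    and "sem setup_search s ''out'' 0 = of_bool (s ''l'' 0 = 0)"
    and "\<And>y. y \<noteq> ''q'' \<Longrightarrow> y \<noteq> ''out'' \<Longrightarrow> sem setup_search s y = s y"
proof -
  let ?P = "Upd ''q'' (Const 1) (SumT vcount (Ret (cell ''q'')))"
  define s1 where "s1 = sem (Upd ''q'' (Const 1) (Ret (Const 1))) s"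
  have s1: "s1 ''q'' 0 = 1" "\<And>y. y \<noteq> ''q'' \<Longrightarrow> s1 y = s y" by (simp_all add: s1_def)
  define s2 where "s2 = (sem ?P ^^ s1 ''m'' 0) s1"
  have loop: "(sem ?P ^^ i) s1 ''q'' 0 = s ''n'' 0 ^ i \<and> (\<forall>y. y \<noteq> ''q'' \<longrightarrow> (sem ?P ^^ i) s1 y = s1 y)" for i
    by (induction i) (simp_all add: s1)
  then have s2: "s2 ''q'' 0 = s ''n'' 0 ^ s ''m'' 0" "\<And>y. y \<noteq> ''q'' \<Longrightarrow> s2 y = s y"
    unfolding s2_def using s1(2) by simp_all
  have sem: "sem setup_search s = sem (Upd ''out'' (Const 1) (Neg (Ret (cell ''l'')))) s2"
    by (simp only: setup_search_def sem.simps val.simps s1_def s2_def)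
  show "sem setup_search s ''q'' 0 = s ''n'' 0 ^ s ''m'' 0" unfolding sem using s2 by simp
  show "sem setup_search s ''out'' 0 = of_bool (s ''l'' 0 = 0)" unfolding sem using s2 by simp
  show "sem setup_search s y = s y" if "y \<noteq> ''q''" "y \<noteq> ''out''" for y
    unfolding sem using s2 that by simp
qed

definition ready :: "nat \<Rightarrow> (nat \<Rightarrow> nat \<Rightarrow> bool) \<Rightarrow> nat set \<Rightarrow> nat \<Rightarrow> nat \<Rightarrow> state \<Rightarrow> bool" where
  "ready n E X m l s \<longleftrightarrow> stores_graph n E s \<and> members n ''X'' s = X \<and> s ''m'' 0 = m \<and> s ''l'' 0 = l \<and>
    s ''a'' = (\<lambda>_. 0) \<and> s ''q'' 0 = n ^ m \<and> s ''out'' 0 = of_bool (l = 0)"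

lemma search_inv_iterate:
  assumes "ready n E X m l s" "0 < m" "i \<le> n ^ m"
  shows "search_inv n E X m l r i ((sem (search_step r) ^^ i) s)"
  using assms(3)
proof (induction i)
  case 0
  then show ?case using assms(1) by (simp add: ready_def search_inv_def digit_def)
next
  case (Suc i)
  \<comment> \<open>A further round exists only if \<open>n ^ m\<close> is positive, which for
    \<open>m > 0\<close> excludes base 0.\<close>
  then have "0 < n" using assms(2) by (cases n) (auto simp: power_0_left)
  with sem_search_step[of n E X m l r i] Suc show ?case by simp
qed

lemma ready_setup:
  assumes pg: "pair_graph G" and V: "pverts G = {..<n}"
  shows "ready n (\<lambda>u v. (u, v) \<in> parcs G) {v. v < n \<and> h_index G < out_degree (with_proj G) v}
    (2 * 8 ^ h_index G) l (sem setup_search (sem setup_width (sem setup_graph (input_state G l))))"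
proof -
  define s1 where "s1 = sem setup_graph (input_state G l)"
  define s2 where "s2 = sem setup_width s1"
  define s3 where "s3 = sem setup_search s2"
  note 1 = sem_setup_graph[OF assms, of l, folded s1_def]
  have m: "s2 ''m'' 0 = 2 * 8 ^ h_index G" using sem_setup_width(1)[of s1] 1 by (simp add: s2_def)
  have s2: "s2 y = s1 y" if "y \<noteq> ''m''" for y using that sem_setup_width(2)[of y s1] by (simp add: s2_def)
  have s3: "s3 y = s2 y" if "y \<noteq> ''q''" "y \<noteq> ''out''" for y
    using that sem_setup_search(3)[of y s2] by (simp add: s3_def)
  have n: "s2 ''n'' 0 = n" using 1(1) by (simp add: stores_graph_def s2)
  have "s3 ''q'' 0 = n ^ (2 * 8 ^ h_index G)" "s3 ''out'' 0 = of_bool (l = 0)"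
    using sem_setup_search(1,2)[of s2] m n 1 by (simp_all add: s3_def s2)
  moreover have "stores_graph n (\<lambda>u v. (u, v) \<in> parcs G) s3"
    by (rule stores_graph_cong[OF 1(1)]) (simp_all add: s3 s2)
  moreover have "members n ''X'' s3 = {v. v < n \<and> h_index G < out_degree (with_proj G) v}"
    using 1(3) members_cong[of s3 "''X''" s1] by (simp add: s3 s2)
  ultimately show ?thesis
    using m 1 unfolding ready_def s3_def[symmetric, unfolded s2_def s1_def]
    by (simp add: s3 s2 s1_def[symmetric] s2_def[symmetric] s3_def[symmetric])
qed

text \<open>Combines soundness of each test with the existence of a correct guess. The empty
  solution is split off as \<open>l = 0\<close>, since a tuple of positive length never names the
  empty set.\<close>

lemma search_correct:
  fixes r l :: nat
  assumes pg: "pair_graph G" and V: "pverts G = {..<n}"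
  defines "X \<equiv> {v. v < n \<and> h_index G < out_degree (with_proj G) v}" and "m \<equiv> 2 * 8 ^ h_index G"
  shows "vertex_triangle_2_club r G l \<longleftrightarrow> l = 0 \<or>
    (\<exists>b < n ^ m. accepts (\<lambda>u v. (u, v) \<in> parcs G) r {..<n} X l (digit n b ` {..<m}))"
proof -
  interpret pair_graph G by fact
  let ?E = "\<lambda>u v. (u, v) \<in> parcs G" and ?k = "h_index G"
  have sym: "symp ?E" using pair_sym_arcs by (auto simp: symmetric_def intro!: sympI dest: symD)
  have edge: "v \<in> {..<n}" if "?E u v" for u v using in_arcsD2[OF that] V by simp
  \<comment> \<open>Maximality of the h-index at threshold \<open>k + 1\<close> says that at most
    \<open>k\<close> vertices have degree above \<open>k\<close>.\<close>
  have "\<not> Suc ?k \<le> ?k" by simp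
  then have "\<not> Suc ?k \<le> card {v \<in> pverts G. Suc ?k \<le> out_degree (with_proj G) v}"
    unfolding h_index_bound[OF pg] .
  moreover have "{v \<in> pverts G. Suc ?k \<le> out_degree (with_proj G) v} = X"
    unfolding X_def V by auto
  ultimately have X: "finite X" "card X \<le> ?k" by (simp_all add: X_def)
  have deg: "card {w. ?E v w} \<le> ?k" if "v \<in> {..<n} - X" for v
    using that by (auto simp: X_def out_degree_with_proj)
  have m: "0 < m" by (simp add: m_def)
  show ?thesis unfolding vertex_triangle_2_club_iff[OF pg] V
  proof
    assume "\<exists>S. solution ?E r {..<n} S l"
    then obtain S where S: "solution ?E r {..<n} S l" by blast
    show "l = 0 \<or> (\<exists>b < n ^ m. accepts ?E r {..<n} X l (digit n b ` {..<m}))"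
    proof (cases "S = {}")
      case True
      then show ?thesis using S by (simp add: solution_def)
    next
      case False
      have SV: "S \<subseteq> {..<n}" and near: "\<And>u v. u \<in> S \<Longrightarrow> v \<in> S \<Longrightarrow> near ?E S u v"
        using S by (auto simp: solution_def good_def)
      obtain F where F: "card F \<le> ?k + 2 ^ ?k * (1 + ?k + ?k * ?k)" "F \<subseteq> S" "S \<inter> X \<subseteq> F"
        and type: "\<forall>v\<in>S - X. \<exists>f\<in>F - X. \<forall>x\<in>S \<inter> X. ?E v x \<longleftrightarrow> ?E f x"
        and meet: "\<forall>v\<in>S - X - F. \<forall>g\<in>S - X. \<exists>x\<in>S \<inter> X. ?E v x \<and> ?E g x"
        by (rule guess_exists[where E="?E", OF finite_lessThan sym edge X deg SV near])
      \<comment> \<open>A vertex of \<open>S\<close> lies in \<open>X\<close>, hence in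
        \<open>F\<close>, or has a look-alike in \<open>F\<close>.\<close>
      have "F \<noteq> {}" using False F(3) type by blast
      moreover have "card F \<le> m" using F(1) guess_size[of ?k] by (simp add: m_def)
      ultimately obtain b where "b < n ^ m" "digit n b ` {..<m} = F"
        using digit_set_surj[of F n m] F(2) SV by blast
      moreover have "accepts ?E r {..<n} X l F"
        by (rule accepts_complete[where E="?E", OF finite_lessThan sym S F(2,3) type meet])
      ultimately show ?thesis by blast
    qed
  next
    assume "l = 0 \<or> (\<exists>b < n ^ m. accepts ?E r {..<n} X l (digit n b ` {..<m}))"
    then show "\<exists>S. solution ?E r {..<n} S l"
    proof
      assume "l = 0"
      then show ?thesis by (intro exI[of _ "{}"]) (simp add: solution_def)
    next
      assume "\<exists>b < n ^ m. accepts ?E r {..<n} X l (digit n b ` {..<m})"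
      then obtain b where b: "b < n ^ m" "accepts ?E r {..<n} X l (digit n b ` {..<m})" by blast
      then have "0 < n" using m by (cases n) (auto simp: power_0_left)
      then have "digit n b ` {..<m} \<subseteq> {..<n}" using digit_less by auto
      then show ?thesis using accepts_sound b(2) by blast
    qed
  qed
qed

lemma sem_main_prog:
  assumes "pair_graph G" "pverts G = {..<n}"
  shows "sem (main_prog r) (input_state G l) ''out'' 0 = of_bool (vertex_triangle_2_club r G l)"
proof -
  define s where "s = sem setup_search (sem setup_width (sem setup_graph (input_state G l)))"
  note R = ready_setup[OF assms, of l, folded s_def]
  have "s ''q'' 0 = n ^ (2 * 8 ^ h_index G)" using R by (simp add: ready_def)
  then have "sem (main_prog r) (input_state G l) = (sem (search_step r) ^^ (n ^ (2 * 8 ^ h_index G))) s"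
    by (simp add: main_prog_def s_def)
  then show ?thesis
    using search_inv_iterate[OF R _ order_refl, of r] search_correct[OF assms, of r l]
    by (simp add: search_inv_def)
qed

section \<open>Running time\<close>

text \<open>The base \<open>Suc N\<close> is at least 1, so a single monomial absorbs all lower
  powers and sums stay of this form.\<close>

definition poly_bounded :: "(nat \<Rightarrow> nat) \<Rightarrow> bool" where
  "poly_bounded f \<longleftrightarrow> (\<exists>C D. \<forall>N. f N \<le> C * Suc N ^ D)"

lemma poly_bounded_const: "poly_bounded (\<lambda>_. c)"
  unfolding poly_bounded_def by (intro exI[of _ c] exI[of _ 0]) simp

lemma poly_bounded_id: "poly_bounded (\<lambda>N. N)"
  unfolding poly_bounded_def by (intro exI[of _ 1]) simp

lemma poly_bounded_add:
  assumes "poly_bounded f" "poly_bounded g"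
  shows "poly_bounded (\<lambda>N. f N + g N)"
proof -
  from assms obtain C D C' D' where
    f: "\<And>N. f N \<le> C * Suc N ^ D" and g: "\<And>N. g N \<le> C' * Suc N ^ D'"
    unfolding poly_bounded_def by blast
  have "f N + g N \<le> (C + C') * Suc N ^ (D + D')" for N
  proof -
    have "f N \<le> C * Suc N ^ (D + D')"
      by (rule order_trans[OF f]) (intro mult_left_mono power_increasing; simp)
    moreover have "g N \<le> C' * Suc N ^ (D + D')"
      by (rule order_trans[OF g]) (intro mult_left_mono power_increasing; simp)
    ultimately show ?thesis by (simp only: add_mult_distrib add_mono)
  qed
  then show ?thesis unfolding poly_bounded_def by blast
qed

lemma poly_bounded_mult:
  assumes "poly_bounded f" "poly_bounded g"
  shows "poly_bounded (\<lambda>N. f N * g N)"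
proof -
  from assms obtain C D C' D' where
    f: "\<And>N. f N \<le> C * Suc N ^ D" and g: "\<And>N. g N \<le> C' * Suc N ^ D'"
    unfolding poly_bounded_def by blast
  have "f N * g N \<le> (C * C') * Suc N ^ (D + D')" for N
    using mult_mono[OF f g, of N N] by (simp add: power_add mult_ac)
  then show ?thesis unfolding poly_bounded_def by blast
qed

lemmas poly_bounded_intros =
  poly_bounded_const poly_bounded_id poly_bounded_add poly_bounded_mult

lemma poly_bounded_tcost: "poly_bounded (tcost t)"
proof (induction t)
  case (Ret e)
  have "tcost (Ret e) = (\<lambda>N. cost e + 2)" by (rule ext) simp
  then show ?case by (simp only: poly_bounded_const)
next
  case (SumT b t)
  have "tcost (SumT b t) = (\<lambda>N. (cost b + 12) + N * (tcost t N + 16))" by (rule ext) simp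
  then show ?case by (simp only:) (intro poly_bounded_intros SumT)
next
  case (IfT c a b)
  have "tcost (IfT c a b) = (\<lambda>N. tcost c N + tcost a N + tcost b N + 3)" by (rule ext) simp
  then show ?case by (simp only:) (intro poly_bounded_intros IfT)
next
  case (GeT t e)
  have "tcost (GeT t e) = (\<lambda>N. tcost t N + cost e + 7)" by (rule ext) simp
  then show ?case by (simp only:) (intro poly_bounded_intros GeT)
qed

primrec pcost :: "prog \<Rightarrow> nat \<Rightarrow> nat" where
  "pcost (Upd a b t) N = upd_cost b t N"
| "pcost (Then p q) N = pcost p N + pcost q N"
| "pcost (Rep b p) N = N * (pcost p N + 9) + cost b + 5"

lemma poly_bounded_pcost: "poly_bounded (pcost p)"
proof (induction p)
  case (Upd a b t)
  have "pcost (Upd a b t) = (\<lambda>N. 2 * cost b + 12 + N * (tcost t N + 40))"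
    by (rule ext) (simp add: upd_cost_def)
  then show ?case by (simp only:) (intro poly_bounded_intros poly_bounded_tcost)
next
  case (Then p q)
  have "pcost (Then p q) = (\<lambda>N. pcost p N + pcost q N)" by (rule ext) simp
  then show ?case by (simp only:) (intro poly_bounded_intros Then)
next
  case (Rep b p)
  have "pcost (Rep b p) = (\<lambda>N. N * (pcost p N + 9) + cost b + 5)" by (rule ext) simp
  then show ?case by (simp only:) (intro poly_bounded_intros Rep)
qed

primrec writes :: "prog \<Rightarrow> string set" where
  "writes (Upd a b t) = {a}"
| "writes (Then p q) = writes p \<union> writes q"
| "writes (Rep b p) = writes p"

primrec prog_bounds :: "prog \<Rightarrow> expr set" where
  "prog_bounds (Upd a b t) = insert b (bounds t)"
| "prog_bounds (Then p q) = prog_bounds p \<union> prog_bounds q"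
| "prog_bounds (Rep b p) = insert b (prog_bounds p)"

lemma sem_writes: "y \<notin> writes p \<Longrightarrow> sem p s y = s y"
proof (induction p arbitrary: s)
  case (Rep b p)
  have "(sem p ^^ i) s y = s y" for i using Rep by (induction i) auto
  then show ?case by simp
qed auto

text \<open>Loop bounds are 1 or cells of \<open>A\<close>, and \<open>p\<close> never writes
  \<open>A\<close>, so one \<open>N\<close> stays valid throughout the run. This is why the setup is
  split into phases: each bounds its loops by values that it leaves unchanged.\<close>

lemma takes_pcost:
  assumes "wf_prog p" "prog_bounds p \<subseteq> insert (Const 1) (cell ` A)" "A \<inter> writes p = {}"
    and "0 < N" "\<And>a. a \<in> A \<Longrightarrow> s a 0 \<le> N"
  shows "takes p d s (pcost p N)"
  using assms
proof (induction p arbitrary: s d)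
  case (Upd a b t)
  have "val e s \<le> N" if "e \<in> insert b (bounds t)" for e
    using that Upd.prems(2,4,5) by auto
  then show ?case using takes_Upd[OF Upd.prems(1)] by simp
next
  case (Then p q)
  have "takes p d s (pcost p N)" using Then.prems by (intro Then.IH(1)) auto
  moreover have "takes q d (sem p s) (pcost q N)"
  proof (rule Then.IH(2))
    fix a assume a: "a \<in> A"
    then have "a \<notin> writes p" using Then.prems(3) by auto
    then show "sem p s a 0 \<le> N" using Then.prems(5)[OF a] by (simp add: sem_writes)
  qed (use Then.prems in auto)
  ultimately show ?case by (simp add: takes_Then)
next
  case (Rep b p)
  have "takes p (Suc d) ((sem p ^^ i) s) (pcost p N)" for i
  proof (rule Rep.IH)
    fix a assume a: "a \<in> A"
    then have "a \<notin> writes p" using Rep.prems(3) by auto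
    then have "(sem p ^^ i) s a = s a" by (induction i) (simp_all add: sem_writes)
    then show "(sem p ^^ i) s a 0 \<le> N" using Rep.prems(5)[OF a] by simp
  qed (use Rep.prems in auto)
  then have "takes (Rep b p) d s (val b s * (pcost p N + 9) + cost b + 5)"
    using Rep.prems(1) by (intro takes_Rep) auto
  moreover have "val b s \<le> N" using Rep.prems(2,4,5) by auto
  ultimately show ?case by (elim takes_mono) (simp add: mult_right_mono)
qed

lemmas prog_defs = setup_graph_def setup_width_def setup_search_def search_step_def find_club_def
  Candidate_def Good_def Near_def Links_def tm_defs Let_def scratch_def

text \<open>With \<open>N = n + m\<close> every loop is covered except the one over tuples, whose
  count \<open>n ^ m\<close> enters explicitly through \<open>takes_Rep\<close>.\<close>

lemma takes_main_prog:
  assumes pg: "pair_graph G" and V: "pverts G = {..<n}" and m: "m = 2 * 8 ^ h_index G"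
  shows "takes (main_prog r) 0 (input_state G l)
    (pcost setup_graph (n + m) + (pcost setup_width (n + m) + (pcost setup_search (n + m) +
      (n ^ m * (pcost (search_step r) (n + m) + 9) + 7))))"
proof -
  define s0 where "s0 = input_state G l"
  define s1 where "s1 = sem setup_graph s0"
  define s2 where "s2 = sem setup_width s1"
  define s3 where "s3 = sem setup_search s2"
  let ?N = "n + m"
  have N: "0 < ?N" using m by simp
  note R = ready_setup[OF pg V, of l, folded s0_def, folded s1_def, folded s2_def, folded s3_def, folded m]
  have n0: "s0 ''n'' 0 = n" using V by (simp add: s0_def input_state_def Let_def)
  have k1: "s1 ''k'' 0 \<le> ?N"
  proof -
    have "s1 ''k'' 0 = h_index G" unfolding s1_def s0_def by (rule sem_setup_graph(2)[OF pg V])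
    also have "\<dots> \<le> 8 ^ h_index G" using less_exp[of "h_index G"] power_mono[of 2 8 "h_index G"] by simp
    also have "\<dots> \<le> ?N" using m by simp
    finally show ?thesis .
  qed
  have n2: "s2 ''n'' 0 = n" and m2: "s2 ''m'' 0 = m"
    using R sem_setup_search(3)[of _ s2] by (simp_all add: ready_def stores_graph_def s3_def)
  have inv: "search_inv n (\<lambda>u v. (u, v) \<in> parcs G) {v. v < n \<and> h_index G < out_degree (with_proj G) v}
      m l r i ((sem (search_step r) ^^ i) s3)" if "i \<le> n ^ m" for i
    using that m by (intro search_inv_iterate[OF R]) auto
  have "takes setup_graph 0 s0 (pcost setup_graph ?N)"
    by (rule takes_pcost[where A="{''n''}"]) (use n0 N in \<open>auto simp: prog_defs\<close>)
  moreover have "takes setup_width 0 s1 (pcost setup_width ?N)"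
    by (rule takes_pcost[where A="{''k''}"]) (use k1 N in \<open>auto simp: prog_defs\<close>)
  moreover have "takes setup_search 0 s2 (pcost setup_search ?N)"
    by (rule takes_pcost[where A="{''n'', ''m''}"]) (use n2 m2 N in \<open>auto simp: prog_defs\<close>)
  moreover have "takes (Rep (cell ''q'') (search_step r)) 0 s3
      (n ^ m * (pcost (search_step r) ?N + 9) + 7)"
  proof -
    have q: "val (cell ''q'') s3 = n ^ m" using R by (simp add: ready_def)
    have step: "takes (search_step r) (Suc 0) ((sem (search_step r) ^^ i) s3) (pcost (search_step r) ?N)"
      if "i < n ^ m" for i
    proof (rule takes_pcost[where A="{''n'', ''m''}"])
      show "wf_prog (search_step r)" by (simp add: prog_defs)
      show "prog_bounds (search_step r) \<subseteq> insert (Const 1) (cell ` {''n'', ''m''})"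
        by (auto simp: prog_defs)
      show "{''n'', ''m''} \<inter> writes (search_step r) = {}" by (simp add: prog_defs)
      have "i \<le> n ^ m" using that by simp
      then show "(sem (search_step r) ^^ i) s3 a 0 \<le> ?N" if "a \<in> {''n'', ''m''}" for a
        using inv that by (auto simp: search_inv_def stores_graph_def)
    qed (rule N)
    have "takes (Rep (cell ''q'') (search_step r)) 0 s3
        (val (cell ''q'') s3 * (pcost (search_step r) ?N + 9) + cost (cell ''q'') + 5)"
      by (rule takes_Rep, simp add: scratch_def, rule step, simp only: q)
    then show ?thesis unfolding q by (rule takes_mono) simp
  qed
  ultimately show ?thesis
    unfolding main_prog_def s0_def[symmetric] s3_def s2_def s1_def by (intro takes_Then)
qed

lemma answers_main_prog:
  assumes "pair_graph G" "pverts G = {..<n}" "takes (main_prog r) 0 (input_state G l) T"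
  shows "answers_in_time (compile_prog (main_prog r) 0) (input_state G l) (vertex_triangle_2_club r G l) T"
proof -
  have "runs (compile_prog (main_prog r) 0) (input_state G l) T
      (simulates 0 (sem (main_prog r) (input_state G l)) (input_state G l))"
    using assms(3) by (simp add: takes_def agree_def)
  moreover have "s' ''out'' 0 = (if vertex_triangle_2_club r G l then 1 else 0)"
    if "simulates 0 (sem (main_prog r) (input_state G l)) (input_state G l) s'" for s'
  proof -
    have "s' ''out'' = sem (main_prog r) (input_state G l) ''out''"
      using that by (simp add: simulates_def agree_def scratch_def)
    then show ?thesis using sem_main_prog[OF assms(1,2)] by simp
  qed
  ultimately show ?thesis unfolding answers_in_time_def runs_def by blast
qed

lemma main_prog_time:
  "\<exists>c. \<forall>n k m. m = 2 * 8 ^ k \<longrightarrow> pcost setup_graph (n + m) + (pcost setup_width (n + m) +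
     (pcost setup_search (n + m) + (n ^ m * (pcost (search_step r) (n + m) + 9) + 7)))
     \<le> 2 ^ (c + c * k) * max 1 n ^ (2 ^ (c + 3 * k))"
proof -
  \<comment> \<open>The constant 16 collects the 9 per tuple and the final 7.\<close>
  let ?A = "\<lambda>N. pcost setup_graph N + pcost setup_width N + pcost setup_search N +
    pcost (search_step r) N + 16"
  have "poly_bounded ?A" by (intro poly_bounded_intros poly_bounded_pcost)
  then obtain C D where A: "\<And>N. ?A N \<le> C * Suc N ^ D" unfolding poly_bounded_def by blast
  \<comment> \<open>\<open>C + 6 * D\<close> dominates the exponent
    \<open>C + (3 + 3 * k) * D\<close> of the polynomial factor; together with the added 2 it also
    covers the \<open>D + 1\<close> in the exponent of \<open>n\<close>.\<close>
  define c where "c = C + 6 * D + 2"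
  show ?thesis
  proof (intro exI[of _ c] allI impI)
    fix n k m :: nat assume m: "m = 2 * 8 ^ k"
    \<comment> \<open>Replacing \<open>n\<close> by at least 1 keeps the bound positive for the
      graph without vertices, on which the setup still takes time.\<close>
    let ?N = "n + m" and ?x = "max 1 n"
    have x: "1 \<le> ?x" "n \<le> ?x" and m1: "1 \<le> m" using m by auto
    have q: "n ^ m \<le> ?x ^ m" "1 \<le> ?x ^ m" using x by (auto intro: power_mono)
    have "pcost setup_graph ?N + (pcost setup_width ?N + (pcost setup_search ?N +
        (n ^ m * (pcost (search_step r) ?N + 9) + 7))) \<le>
        (pcost setup_graph ?N + pcost setup_width ?N + pcost setup_search ?N + 7) * ?x ^ m +
        ?x ^ m * (pcost (search_step r) ?N + 9)"
    proof -
      have "n ^ m * (pcost (search_step r) ?N + 9) \<le> ?x ^ m * (pcost (search_step r) ?N + 9)"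
        using q(1) by (rule mult_right_mono) simp
      moreover have "a \<le> a * ?x ^ m" for a using q(2) by simp
      ultimately show ?thesis by (smt (verit) add.commute add.left_commute add_mono)
    qed
    also have "\<dots> = ?A ?N * ?x ^ m" by (simp add: algebra_simps)
    also have "\<dots> \<le> C * Suc ?N ^ D * ?x ^ m" by (intro mult_right_mono A) simp
    \<comment> \<open>Each of \<open>1\<close>, \<open>n\<close> and \<open>m\<close> is at most
      \<open>m * ?x\<close>; the factor 4 instead of 3 makes \<open>4 * m\<close> the power of two
      \<open>8 * 8 ^ k\<close>.\<close>
    also have "\<dots> \<le> C * (4 * m * ?x) ^ D * ?x ^ m"
    proof -
      have "n \<le> m * ?x" "m \<le> m * ?x" "1 \<le> m * ?x"
        using x m1 by (metis mult_le_mono nat_mult_1, simp, simp)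
      then have "Suc ?N \<le> 4 * m * ?x" by linarith
      then show ?thesis by (intro mult_right_mono mult_left_mono power_mono) simp_all
    qed
    also have "\<dots> = C * (8 * 8 ^ k) ^ D * ?x ^ (D + m)"
      by (simp add: m power_mult_distrib power_add mult_ac)
    also have "\<dots> \<le> 2 ^ (c + c * k) * ?x ^ (2 ^ (c + 3 * k))"
    proof (rule mult_mono)
      have "C * (8 * 8 ^ k) ^ D \<le> 2 ^ C * (8 * 8 ^ k) ^ D"
        using less_exp[of C] by (intro mult_right_mono) auto
      also have "\<dots> = 2 ^ C * (2 ^ (3 + 3 * k)) ^ D" by (simp add: power_add power_mult)
      also have "\<dots> = 2 ^ (C + (3 + 3 * k) * D)" by (simp only: power_add power_mult)
      also have "\<dots> \<le> 2 ^ (c + c * k)"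
        by (intro power_increasing) (auto simp: c_def algebra_simps)
      finally show "C * (8 * 8 ^ k) ^ D \<le> 2 ^ (c + c * k)" .
      have "D + m \<le> (D + 1) * m" using m1 by (simp add: algebra_simps)
      also have "\<dots> \<le> 2 ^ D * m" using less_exp[of D] by (intro mult_right_mono) (simp_all add: Suc_le_eq)
      also have "\<dots> = 2 ^ (D + 1 + 3 * k)" by (simp add: m power_add power_mult)
      also have "\<dots> \<le> 2 ^ (c + 3 * k)" by (intro power_increasing) (auto simp: c_def)
      finally show "?x ^ (D + m) \<le> ?x ^ (2 ^ (c + 3 * k))" using x by (intro power_increasing) auto
    qed simp_all
    finally show "pcost setup_graph ?N + (pcost setup_width ?N + (pcost setup_search ?N +
        (n ^ m * (pcost (search_step r) ?N + 9) + 7))) \<le> 2 ^ (c + c * k) * ?x ^ (2 ^ (c + 3 * k))" .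
  qed
qed

text \<open>The program depends on \<open>r\<close> alone; it computes the h-index itself.\<close>

theorem theorem3:
  fixes r :: nat
  assumes "r \<ge> 1"
  shows "\<exists>(p :: com) (f :: nat \<Rightarrow> nat) (g :: nat \<Rightarrow> nat).
    (\<lambda>k. real (f k)) \<in> O(\<lambda>k. real k ^ 4) \<and>
    (\<lambda>k. real (g k)) \<in> O(\<lambda>k. real k) \<and>
    (\<forall>(n :: nat) (G :: nat pair_pre_digraph) (l :: nat).
       pair_graph G \<longrightarrow> pverts G = {..<n} \<longrightarrow>
       answers_in_time p (input_state G l) (vertex_triangle_2_club r G l)
         (2 ^ f (h_index G) * max 1 n ^ (2 ^ g (h_index G))))"
proof -
  obtain c where c: "\<And>n k. let m = 2 * 8 ^ k in pcost setup_graph (n + m) + (pcost setup_width (n + m) +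
     (pcost setup_search (n + m) + (n ^ m * (pcost (search_step r) (n + m) + 9) + 7)))
     \<le> 2 ^ (c + c * k) * max 1 n ^ (2 ^ (c + 3 * k))"
    using main_prog_time[of r] by (auto simp: Let_def)
  \<comment> \<open>The exponent is even linear in \<open>k\<close>. Only \<open>k \<ge> 1\<close>
    is compared, because \<open>k ^ 4\<close> vanishes at 0.\<close>
  have "(\<lambda>k. real (c + c * k)) \<in> O(\<lambda>k. real k ^ 4)"
  proof (rule bigoI[where c="2 * real c"], rule eventually_mono[OF eventually_ge_at_top[of 1]])
    fix k :: nat assume k: "1 \<le> k"
    have "k ^ 1 \<le> k ^ 4" using k by (intro power_increasing) auto
    then have "c * 1 \<le> c * k ^ 4" "c * k \<le> c * k ^ 4" using k by (intro mult_left_mono; simp)+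
    then have "c + c * k \<le> 2 * c * k ^ 4" by linarith
    then have "real (c + c * k) \<le> real (2 * c * k ^ 4)" by (simp only: of_nat_le_iff)
    then show "norm (real (c + c * k)) \<le> 2 * real c * norm (real k ^ 4)" by simp
  qed
  moreover have "(\<lambda>k. real (c + 3 * k)) \<in> O(\<lambda>k. real k)"
  proof (rule bigoI[where c="real c + 3"], rule eventually_mono[OF eventually_ge_at_top[of 1]])
    fix k :: nat assume "1 \<le> k"
    then have "real c * 1 \<le> real c * real k" by (intro mult_left_mono) auto
    then show "norm (real (c + 3 * k)) \<le> (real c + 3) * norm (real k)" by (simp add: algebra_simps)
  qed
  moreover have "answers_in_time (compile_prog (main_prog r) 0) (input_state G l) (vertex_triangle_2_club r G l)
      (2 ^ (c + c * h_index G) * max 1 n ^ (2 ^ (c + 3 * h_index G)))"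
    if "pair_graph G" "pverts G = {..<n}" for n G l
    using that c[of "h_index G" n] takes_main_prog[OF that refl, of r l]
    unfolding Let_def by (blast intro: answers_main_prog takes_mono)
  ultimately show ?thesis
    by (intro exI[of _ "compile_prog (main_prog r) 0"] exI[of _ "\<lambda>k. c + c * k"]
        exI[of _ "\<lambda>k. c + 3 * k"] conjI allI impI)
qed

end
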